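(* Let $R$ be a commutative ring all of whose Pierce stalks are projective free rings. Let $n\ge 2$ and let $h\in R[t]$ be a monic polynomial of degree $n$. Then the following are equivalent: (1) Every $A\in \mathbf{M}_n(R)$ with characteristic polynomial $\chi(A)=h$ is strongly clean. (2) The companion matrix $C_h$ of $h$ is strongly clean. (3) There exists a gSRC-factorization of $h$ in $R[t]$.
   Context: All rings are unital. $\mathbf{M}_n(R)$ is the ring of $n\times n$ matrices over $R$, $\mathbf{U}(S)$ is the group of units of a ring $S$, and $\chi(A)$ is the characteristic polynomial of a square matrix $A$ over a commutative ring. For a commutative ring $R$, $\mathbf{B}(R)$ denotes the boolean ring of idempotents of $R$ (equivalently, boolean algebra), and $\operatorname{Spec}\mathbf{B}(R)$ its prime spectrum. For $x\in\operatorname{Spec}\mathbf{B}(R)$, the Pierce stalk of $R$ at $x$ is $R_x=R/xR$, where $xR$ is the ideal of $R$ generated by $x$. A commutative ring is projective free if every finitely generated projective module over it is free. An element $r$ of a ring $S$ is strongly clean if $r=e+u$ with $e\in S$ idempotent, $u\in\mathbf{U}(S)$ and $eu=ue$. For a commutative ring $S$ and a monic $f\in S[t]$, a factorization $f=f_0f_1$ into monic polynomials of $S[t]$ is an SR-factorization if $f_0(0)\in\mathbf{U}(S)$ and $f_1(1)\in\mathbf{U}(S)$; it is an SRC-factorization if in addition the ideal $(f_0,f_1)$ equals $S[t]$. A complete orthogonal set of idempotents of $R$ is a finite set of pairwise orthogonal idempotents of $R$ whose sum is $1$. A monic $h\in R[t]$ of degree $\ge 1$ has a gSRC-factorization if there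 is a complete orthogonal set of idempotents $\{e_1,\ldots,e_k\}$ of $R$, depending on $h$, such that for each $i=1,\ldots,k$ the polynomial $he_i$ has an SRC-factorization in $e_iR[t]$ (where $e_iR$ is regarded as a ring with identity $e_i$). *)

theory Defs
  imports
    "HOL-Library.FuncSet"
    "HOL-Algebra.QuotRing"
    "HOL-Algebra.Module"
    "HOL-Algebra.Algebraic_Closure_Type"
    "Jordan_Normal_Form.Char_Poly"
begin

section \<open>Pierce stalks\<close>

definition idempotent_ring :: "'a::comm_ring_1 ring" where
  "idempotent_ring = \<lparr>carrier = {e. e * e = e}, monoid.mult = (*), one = 1, zero = 0,
     add = (\<lambda>e f. e + f - 2 * e * f)\<rparr>"

definition boolean_spectrum :: "'a::comm_ring_1 set set" where
  "boolean_spectrum = {x. primeideal x idempotent_ring}"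

definition pierce_stalk :: "'a::comm_ring_1 set \<Rightarrow> 'a set ring" where
  "pierce_stalk x = ring_of_type_algebra Quot (Idl\<^bsub>ring_of_type_algebra\<^esub> x)"


section \<open>Projective free rings\<close>

definition module_homs ::
    "('s, 'c) ring_scheme \<Rightarrow> ('s, 'm, 'd) module_scheme \<Rightarrow> ('s, 'n, 'e) module_scheme
      \<Rightarrow> ('m \<Rightarrow> 'n) set" where
  "module_homs S M N = {f \<in> carrier M \<rightarrow> carrier N.
     (\<forall>x\<in>carrier M. \<forall>y\<in>carrier M. f (x \<oplus>\<^bsub>M\<^esub> y) = f x \<oplus>\<^bsub>N\<^esub> f y) \<and>
     (\<forall>a\<in>carrier S. \<forall>x\<in>carrier M. f (a \<odot>\<^bsub>M\<^esub> x) = a \<odot>\<^bsub>N\<^esub> f x)}"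

definition finitely_generated_module ::
    "('s, 'c) ring_scheme \<Rightarrow> ('s, 'm, 'd) module_scheme \<Rightarrow> bool" where
  "finitely_generated_module S M \<longleftrightarrow>
     (\<exists>G. finite G \<and> G \<subseteq> carrier M \<and>
        (\<forall>x\<in>carrier M. \<exists>c\<in>G \<rightarrow> carrier S. x = (\<Oplus>\<^bsub>M\<^esub>g\<in>G. c g \<odot>\<^bsub>M\<^esub> g)))"

definition module_basis ::
    "('s, 'c) ring_scheme \<Rightarrow> ('s, 'm, 'd) module_scheme \<Rightarrow> 'm set \<Rightarrow> bool" where
  "module_basis S M B \<longleftrightarrow> B \<subseteq> carrier M \<and>
     (\<forall>x\<in>carrier M. \<exists>!c. c \<in> B \<rightarrow>\<^sub>E carrier S \<and> finite {b \<in> B. c b \<noteq> \<zero>\<^bsub>S\<^esub>} \<and>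
        x = (\<Oplus>\<^bsub>M\<^esub>b\<in>{b \<in> B. c b \<noteq> \<zero>\<^bsub>S\<^esub>}. c b \<odot>\<^bsub>M\<^esub> b))"

definition free_module ::
    "('s, 'c) ring_scheme \<Rightarrow> ('s, 'm, 'd) module_scheme \<Rightarrow> bool" where
  "free_module S M \<longleftrightarrow> (\<exists>B. module_basis S M B)"

text \<open>
  HOL cannot quantify over the types of the test modules \<open>N\<close> and \<open>L\<close>, so they are taken with
  elements in the same type as \<open>P\<close>. For a finitely generated \<open>P\<close> whose element type is
  \<open>nat \<Rightarrow> 's\<close> this is no restriction: that type contains \<open>S\<^sup>n\<close> for every \<open>n\<close>, and lifting the
  identity of \<open>P\<close> along a surjection from \<open>S\<^sup>n\<close> already makes \<open>P\<close> a direct summand of \<open>S\<^sup>n\<close>.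
\<close>

definition projective_module ::
    "('s, 'c) ring_scheme \<Rightarrow> ('s, 'm) module \<Rightarrow> bool" where
  "projective_module S P \<longleftrightarrow>
     (\<forall>(N :: ('s, 'm) module) (L :: ('s, 'm) module).
        module S N \<longrightarrow> module S L \<longrightarrow>
        (\<forall>g\<in>module_homs S N L. \<forall>f\<in>module_homs S P L.
           g ` carrier N = carrier L \<longrightarrow>
           (\<exists>k\<in>module_homs S P N. \<forall>x\<in>carrier P. g (k x) = f x)))"

text \<open>
  The element type \<open>nat \<Rightarrow> 's\<close> loses no modules: every finitely generated projective module is
  isomorphic to a direct summand of some \<open>S\<^sup>n\<close>, hence to a module with elements in
  \<open>nat \<Rightarrow> 's\<close>.
\<close>

definition projective_free :: "('s, 'c) ring_scheme \<Rightarrow> bool" where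
  "projective_free S \<longleftrightarrow> cring S \<and>
     (\<forall>P :: ('s, nat \<Rightarrow> 's) module.
        module S P \<longrightarrow> finitely_generated_module S P \<longrightarrow> projective_module S P \<longrightarrow>
        free_module S P)"


section \<open>Strongly clean elements and companion matrices\<close>

definition strongly_clean :: "('s, 'c) ring_scheme \<Rightarrow> 's \<Rightarrow> bool" where
  "strongly_clean S r \<longleftrightarrow>
     (\<exists>e\<in>carrier S. \<exists>u\<in>Units S.
        e \<otimes>\<^bsub>S\<^esub> e = e \<and> r = e \<oplus>\<^bsub>S\<^esub> u \<and> e \<otimes>\<^bsub>S\<^esub> u = u \<otimes>\<^bsub>S\<^esub> e)"

abbreviation strongly_clean_mat :: "nat \<Rightarrow> 'a::comm_ring_1 mat \<Rightarrow> bool" where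
  "strongly_clean_mat n A \<equiv> strongly_clean (ring_mat TYPE('a) n ()) A"

definition companion_matrix :: "'a::comm_ring_1 poly \<Rightarrow> 'a mat" where
  "companion_matrix h = mat (degree h) (degree h)
     (\<lambda>(i, j). if Suc j = degree h then - coeff h i else if i = Suc j then 1 else 0)"


section \<open>SRC- and gSRC-factorizations\<close>

text \<open>
  For an idempotent \<open>e\<close> of \<open>R\<close>, \<open>corner_ring e\<close> is \<open>eR\<close> with identity \<open>e\<close>, and
  \<open>corner_poly_ring e\<close> is \<open>eR[t]\<close>, realised inside \<open>R[t]\<close>. The factorization notions for a
  ring \<open>S\<close> are only needed for \<open>S = eR\<close> and are parametrised by \<open>e\<close>; \<open>e = 1\<close> gives \<open>S = R\<close>.
\<close>

definition corner_ring :: "'a::comm_ring_1 \<Rightarrow> 'a ring" where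
  "corner_ring e = \<lparr>carrier = range (\<lambda>r. e * r), monoid.mult = (*), one = e, zero = 0, add = (+)\<rparr>"

definition corner_poly_ring :: "'a::comm_ring_1 \<Rightarrow> 'a poly ring" where
  "corner_poly_ring e = \<lparr>carrier = {f. \<forall>k. coeff f k \<in> carrier (corner_ring e)},
     monoid.mult = (*), one = [:e:], zero = 0, add = (+)\<rparr>"

definition corner_monic :: "'a::comm_ring_1 \<Rightarrow> 'a poly \<Rightarrow> bool" where
  "corner_monic e f \<longleftrightarrow> f \<in> carrier (corner_poly_ring e) \<and> lead_coeff f = e"

text \<open>The element 1 of the ring \<open>eR\<close> is \<open>e\<close>, so \<open>f\<^sub>1(1)\<close> is the value of \<open>f\<^sub>1\<close> at \<open>e\<close>.\<close>

definition SR_factorization ::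
    "'a::comm_ring_1 \<Rightarrow> 'a poly \<Rightarrow> 'a poly \<Rightarrow> 'a poly \<Rightarrow> bool" where
  "SR_factorization e f f\<^sub>0 f\<^sub>1 \<longleftrightarrow>
     corner_monic e f \<and> corner_monic e f\<^sub>0 \<and> corner_monic e f\<^sub>1 \<and> f = f\<^sub>0 * f\<^sub>1 \<and>
     poly f\<^sub>0 0 \<in> Units (corner_ring e) \<and> poly f\<^sub>1 e \<in> Units (corner_ring e)"

definition SRC_factorization ::
    "'a::comm_ring_1 \<Rightarrow> 'a poly \<Rightarrow> 'a poly \<Rightarrow> 'a poly \<Rightarrow> bool" where
  "SRC_factorization e f f\<^sub>0 f\<^sub>1 \<longleftrightarrow> SR_factorization e f f\<^sub>0 f\<^sub>1 \<and>
     Idl\<^bsub>corner_poly_ring e\<^esub> {f\<^sub>0, f\<^sub>1} = carrier (corner_poly_ring e)"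

definition complete_orthogonal_idempotents :: "'a::comm_ring_1 set \<Rightarrow> bool" where
  "complete_orthogonal_idempotents E \<longleftrightarrow> finite E \<and> (\<forall>e\<in>E. e * e = e) \<and>
     (\<forall>e\<in>E. \<forall>f\<in>E. e \<noteq> f \<longrightarrow> e * f = 0) \<and> \<Sum>E = 1"

definition has_gSRC_factorization :: "'a::comm_ring_1 poly \<Rightarrow> bool" where
  "has_gSRC_factorization h \<longleftrightarrow>
     (\<exists>E. complete_orthogonal_idempotents E \<and>
        (\<forall>e\<in>E. \<exists>f\<^sub>0 f\<^sub>1. SRC_factorization e (Polynomial.smult e h) f\<^sub>0 f\<^sub>1))"

end

theory Submission
  imports Defs
begin

text \<open>
  A matrix with characteristic polynomial \<open>h\<close> receives, by Cayley-Hamilton, a homomorphism from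
  \<open>R[t]/(h)\<close>. If \<open>h\<close> has a gSRC-factorization then \<open>t\<close> itself is strongly clean in \<open>R[t]/(h)\<close>
  (\<open>gSRC_factorization_imp_polys\<close>): over each corner the Chinese remainder theorem separates a factor
  where \<open>t\<close> is a unit from one where \<open>t - 1\<close> is a unit. So every such matrix is strongly clean, in
  particular the companion matrix, whose characteristic polynomial is \<open>h\<close>.

  Conversely let \<open>C\<^sub>h = E + U\<close> be a strongly clean decomposition. One would like to take for \<open>f\<^sub>1\<close> and
  \<open>f\<^sub>0\<close> the characteristic polynomials of \<open>C\<^sub>h\<close> on \<open>im E\<close> and on \<open>im (1 - E)\<close>. These modules are only
  projective, but the characteristic polynomials can be defined globally: extend an
  endomorphism of \<open>im E\<close> by the identity on the complement and take the determinant. This gives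
  \<open>g\<^sub>1 = det (E (t - C\<^sub>h) + (1 - E))\<close> and likewise \<open>g\<^sub>0\<close>, with \<open>g\<^sub>0 g\<^sub>1 = h\<close> by multiplicativity. The
  values \<open>g\<^sub>0(0)\<close> and \<open>g\<^sub>1(1)\<close> are determinants of \<open>- U\<close> on the two modules, hence units, and
  \<open>g\<^sub>0\<close>, \<open>g\<^sub>1\<close> are comaximal because \<open>C\<^sub>h\<close> is cyclic (\<open>companion_char_polys_comaximal\<close>).

  What fails globally is monicity, because the rank of \<open>im E\<close> may vary over the spectrum. The
  coefficients \<open>e\<^sub>d\<close> of the rank polynomial \<open>det (E t + (1 - E))\<close> form a complete orthogonal set of
  idempotents, and \<open>e\<^sub>d g\<^sub>1\<close> is monic of degree \<open>d\<close> over the corner \<open>e\<^sub>d R\<close>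
  (\<open>char_poly_on_image_coeff\<close>, \<open>rank_idempotents\<close>). Hence \<open>e\<^sub>d h = (e\<^sub>d g\<^sub>0) (e\<^sub>d g\<^sub>1)\<close> is an
  SRC-factorization for each \<open>d\<close>.
\<close>

section \<open>Determinants on the image of an idempotent\<close>

text \<open>
  In a ring with complementary idempotents \<open>e\<close>, \<open>f\<close>, the element \<open>e \<otimes> y \<oplus> f\<close> is block diagonal in the
  Peirce decomposition: it is \<open>y\<close> on the first block (when \<open>y\<close> commutes with \<open>e\<close>) and the identity on
  the second. The next two lemmas are the block computations that the determinants below rest on; they
  are done in an abstract ring to keep the dimension side conditions of matrices out of them.
\<close>
lemma (in ring) complementary_idempotents_mult:
  assumes c: "e \<in> carrier R" "f \<in> carrier R" "y \<in> carrier R" "z \<in> carrier R"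
    and i: "e \<otimes> e = e" "f \<otimes> f = f" "e \<otimes> f = \<zero>" "f \<otimes> e = \<zero>" and ey: "e \<otimes> y = y \<otimes> e"
  shows "(e \<otimes> y \<oplus> f) \<otimes> (e \<otimes> z \<oplus> f) = e \<otimes> (y \<otimes> z) \<oplus> f"
proof -
  have 1: "(e \<otimes> y) \<otimes> (e \<otimes> z) = e \<otimes> (y \<otimes> z)"
    using c i ey by (metis m_assoc m_closed)
  have 2: "(e \<otimes> y) \<otimes> f = \<zero>"
    using c i ey by (metis m_assoc r_null)
  have 3: "f \<otimes> (e \<otimes> z) = \<zero>"
    using c i by (metis m_assoc l_null)
  show ?thesis
    using c by (simp add: l_distr r_distr 1 2 3 i)
qed

lemma (in ring) complementary_idempotents_split:
  assumes c: "e \<in> carrier R" "f \<in> carrier R" "y \<in> carrier R"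
    and i: "e \<otimes> e = e" "f \<otimes> f = f" "e \<otimes> f = \<zero>" "f \<otimes> e = \<zero>" "e \<oplus> f = \<one>"
    and ey: "e \<otimes> y = y \<otimes> e" and fy: "f \<otimes> y = y \<otimes> f"
  shows "(e \<otimes> y \<oplus> f) \<otimes> (f \<otimes> y \<oplus> e) = y"
proof -
  have 1: "(e \<otimes> y) \<otimes> (f \<otimes> y) = \<zero>"
    using c i ey by (metis m_assoc m_closed l_null r_null)
  have 2: "(e \<otimes> y) \<otimes> e = e \<otimes> y"
    using c i ey by (metis m_assoc)
  have 3: "f \<otimes> (f \<otimes> y) = f \<otimes> y"
    using c i by (metis m_assoc)
  have "(e \<otimes> y \<oplus> f) \<otimes> (f \<otimes> y \<oplus> e) = e \<otimes> y \<oplus> f \<otimes> y"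
    using c by (simp add: l_distr r_distr 1 2 3 i a_comm)
  also have "\<dots> = (e \<oplus> f) \<otimes> y" using c by (simp only: l_distr)
  also have "\<dots> = y" using c i by simp
  finally show ?thesis .
qed

text \<open>
  If \<open>Y\<close> commutes with the idempotent \<open>E\<close>, this is the determinant of \<open>Y\<close> as an endomorphism of the
  projective module \<open>im E\<close>: it is extended by the identity on the complement \<open>im (1 - E)\<close>, which
  turns it into an endomorphism of a free module without changing its determinant.
\<close>
definition det_on_image :: "'a::comm_ring_1 mat \<Rightarrow> 'a mat \<Rightarrow> 'a" where
  "det_on_image E Y = det (E * Y + (1\<^sub>m (dim_row E) - E))"

lemma complement_closed [simp]:
  "(E :: 'a::comm_ring_1 mat) \<in> carrier_mat n n \<Longrightarrow> 1\<^sub>m n - E \<in> carrier_mat n n"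
  by auto

lemma idempotent_complement:
  fixes E :: "'a::comm_ring_1 mat"
  assumes E: "E \<in> carrier_mat n n" "E * E = E"
  shows "E * (1\<^sub>m n - E) = 0\<^sub>m n n" "(1\<^sub>m n - E) * E = 0\<^sub>m n n"
    "(1\<^sub>m n - E) * (1\<^sub>m n - E) = 1\<^sub>m n - E" "E + (1\<^sub>m n - E) = 1\<^sub>m n" "1\<^sub>m n - (1\<^sub>m n - E) = E"
proof -
  show 1: "E * (1\<^sub>m n - E) = 0\<^sub>m n n"
    using E by (simp add: mult_minus_distrib_mat[of _ n n _ n])
  show 2: "(1\<^sub>m n - E) * E = 0\<^sub>m n n"
    using E by (simp add: minus_mult_distrib_mat[of _ n n _ _ n])
  have "(1\<^sub>m n - E) * (1\<^sub>m n - E) = (1\<^sub>m n - E) * 1\<^sub>m n - (1\<^sub>m n - E) * E"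
    using E by (intro mult_minus_distrib_mat) auto
  then show "(1\<^sub>m n - E) * (1\<^sub>m n - E) = 1\<^sub>m n - E"
    unfolding 2 using E by (auto intro!: eq_matI)
  show "E + (1\<^sub>m n - E) = 1\<^sub>m n" "1\<^sub>m n - (1\<^sub>m n - E) = E"
    using E by (auto intro!: eq_matI)
qed

lemma complement_commute:
  fixes E :: "'a::comm_ring_1 mat"
  assumes "E \<in> carrier_mat n n" "Y \<in> carrier_mat n n" "E * Y = Y * E"
  shows "(1\<^sub>m n - E) * Y = Y * (1\<^sub>m n - E)"
  using assms by (simp add: mult_minus_distrib_mat[of _ n n _ n] minus_mult_distrib_mat[of _ n n _ _ n])

lemma det_on_image_mult:
  fixes E :: "'a::comm_ring_1 mat"
  assumes E: "E \<in> carrier_mat n n" "E * E = E"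
    and c: "Y \<in> carrier_mat n n" "Z \<in> carrier_mat n n" and EY: "E * Y = Y * E"
  shows "det_on_image E (Y * Z) = det_on_image E Y * det_on_image E Z"
proof -
  interpret M: ring "ring_mat TYPE('a) n ()" by (rule ring_mat)
  have "(E * Y + (1\<^sub>m n - E)) * (E * Z + (1\<^sub>m n - E)) = E * (Y * Z) + (1\<^sub>m n - E)"
    using M.complementary_idempotents_mult[of E "1\<^sub>m n - E" Y Z] E c idempotent_complement[OF E]
    by (simp add: ring_mat_simps EY[symmetric])
  then show ?thesis
    unfolding det_on_image_def using E c
    by (auto simp: det_mult[symmetric, of _ n])
qed

lemma det_on_image_one:
  assumes "E \<in> carrier_mat n n" "E * E = E"
  shows "det_on_image E (1\<^sub>m n) = 1"
  using assms idempotent_complement(4)[OF assms] by (simp add: det_on_image_def)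

lemma det_on_image_cong:
  assumes "E * Y = E * Z"
  shows "det_on_image E Y = det_on_image E Z"
  by (simp add: det_on_image_def assms)

lemma det_on_image_factors:
  fixes E :: "'a::comm_ring_1 mat"
  assumes E: "E \<in> carrier_mat n n" "E * E = E"
    and Y: "Y \<in> carrier_mat n n" and EY: "E * Y = Y * E"
  shows "(E * Y + (1\<^sub>m n - E)) * ((1\<^sub>m n - E) * Y + E) = Y"
proof -
  interpret M: ring "ring_mat TYPE('a) n ()" by (rule ring_mat)
  show ?thesis
    using M.complementary_idempotents_split[of E "1\<^sub>m n - E" Y] E Y idempotent_complement[OF E]
      complement_commute[OF E(1) Y EY]
    by (simp add: ring_mat_simps EY[symmetric])
qed

lemma det_on_image_split:
  assumes E: "E \<in> carrier_mat n n" "E * E = E"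
    and Y: "Y \<in> carrier_mat n n" and EY: "E * Y = Y * E"
  shows "det_on_image E Y * det_on_image (1\<^sub>m n - E) Y = det Y"
proof -
  have "det_on_image E Y * det_on_image (1\<^sub>m n - E) Y
      = det (E * Y + (1\<^sub>m n - E)) * det ((1\<^sub>m n - E) * Y + E)"
    using E idempotent_complement(5)[OF E] by (simp add: det_on_image_def)
  also have "\<dots> = det Y"
    using E Y by (subst det_mult[symmetric, of _ n]) (auto simp: det_on_image_factors[OF assms])
  finally show ?thesis .
qed

lemma (in comm_ring_hom) det_on_image_hom:
  assumes "E \<in> carrier_mat n n" "Y \<in> carrier_mat n n"
  shows "det_on_image (map_mat hom E) (map_mat hom Y) = hom (det_on_image E Y)"
proof -
  have "map_mat hom E * map_mat hom Y + (1\<^sub>m n - map_mat hom E) = map_mat hom (E * Y + (1\<^sub>m n - E))"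
    using assms mat_hom_mult[OF assms, symmetric]
    by (auto intro!: eq_matI simp: hom_distribs)
  with assms show ?thesis by (simp add: det_on_image_def hom_det[symmetric] del: hom_det)
qed

text \<open>
  Write \<open>Y = B\<^sub>1 B\<^sub>0\<close> with \<open>B\<^sub>1 = E Y + F\<close>, \<open>B\<^sub>0 = F Y + E\<close>, \<open>F = 1 - E\<close>, and put \<open>M = adj B\<^sub>0 adj B\<^sub>1\<close>.
  Inserting \<open>1 = E + F\<close> between the factors, \<open>B\<^sub>0 E = E\<close> turns one summand into a multiple of
  \<open>det B\<^sub>0\<close>, and \<open>F B\<^sub>1 = F\<close> turns the other into a multiple of \<open>det B\<^sub>1\<close>. So every entry of \<open>M\<close> lies in
  the ideal generated by the two determinants; an entry equal to 1 makes them comaximal.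
\<close>
lemma adjugate_comaximal:
  assumes E: "E \<in> carrier_mat n n" "E * E = E"
    and Y: "Y \<in> carrier_mat n n" and EY: "E * Y = Y * E"
  obtains M A B where "M \<in> carrier_mat n n" "A \<in> carrier_mat n n" "B \<in> carrier_mat n n"
    "Y * M = det Y \<cdot>\<^sub>m 1\<^sub>m n"
    "M = det_on_image E Y \<cdot>\<^sub>m A + det_on_image (1\<^sub>m n - E) Y \<cdot>\<^sub>m B"
proof -
  define F where "F = 1\<^sub>m n - E"
  define B1 where "B1 = E * Y + F"
  define B0 where "B0 = F * Y + E"
  define g1 where "g1 = det_on_image E Y"
  define g0 where "g0 = det_on_image F Y"
  have F: "F \<in> carrier_mat n n" using E by (simp add: F_def)
  have EF: "E * F = 0\<^sub>m n n" "F * E = 0\<^sub>m n n" "F * F = F" "E + F = 1\<^sub>m n" "1\<^sub>m n - F = E"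
    using idempotent_complement[OF E] by (auto simp: F_def)
  have FY: "F * Y = Y * F" unfolding F_def by (rule complement_commute[OF E(1) Y EY])
  have c: "B1 \<in> carrier_mat n n" "B0 \<in> carrier_mat n n" using E F Y by (auto simp: B1_def B0_def)
  have g: "g1 = det B1" "g0 = det B0"
    using E F Y EF by (auto simp: g1_def g0_def det_on_image_def B1_def B0_def F_def)
  note a1 = adj_mat[OF c(1)] and a0 = adj_mat[OF c(2)]
  have Y_eq: "B1 * B0 = Y" unfolding B1_def B0_def F_def by (rule det_on_image_factors[OF E Y EY])
  define M where "M = adj_mat B0 * adj_mat B1"
  have M: "M \<in> carrier_mat n n" using a0 a1 by (simp add: M_def)
  have "Y * M = B1 * (B0 * adj_mat B0) * adj_mat B1"
    unfolding M_def Y_eq[symmetric] using c a0(1) a1(1)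
    by (simp add: assoc_mult_mat[of _ n n _ n _ n])
  also have "\<dots> = g0 \<cdot>\<^sub>m (B1 * adj_mat B1)"
    unfolding a0(2) using c a0(1) a1(1) by (simp add: g mult_smult_distrib[of _ n n _ n] mult_smult_assoc_mat[of _ n n _ n])
  also have "\<dots> = (g1 * g0) \<cdot>\<^sub>m 1\<^sub>m n"
    unfolding a1(2) by (auto intro!: eq_matI simp: g)
  also have "g1 * g0 = det Y"
    unfolding g1_def g0_def F_def by (rule det_on_image_split[OF E Y EY])
  finally have YM: "Y * M = det Y \<cdot>\<^sub>m 1\<^sub>m n" .
  have FB1: "F * B1 = F"
  proof -
    have "F * B1 = F * (E * Y) + F * F" unfolding B1_def using E F Y by (intro mult_add_distrib_mat) auto
    also have "F * (E * Y) = (F * E) * Y" using E F Y by simp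
    finally show ?thesis using F Y by (simp add: EF)
  qed
  have B0E: "B0 * E = E"
  proof -
    have "B0 * E = (F * Y) * E + E * E" unfolding B0_def using E F Y by (intro add_mult_distrib_mat) auto
    also have "(F * Y) * E = Y * (F * E)" unfolding FY using E F Y by simp
    finally show ?thesis using E Y by (simp add: EF)
  qed
  have e1: "E * adj_mat B1 \<in> carrier_mat n n" and e0: "adj_mat B0 * F \<in> carrier_mat n n"
    using E F a0 a1 by auto
  have "M = adj_mat B0 * (E + F) * adj_mat B1"
    unfolding EF M_def using a0 a1 by simp
  also have "\<dots> = adj_mat B0 * E * adj_mat B1 + adj_mat B0 * F * adj_mat B1"
    using E F a0(1) a1(1) by (simp add: mult_add_distrib_mat[of _ n n _ n] add_mult_distrib_mat[of _ n n _ _ n])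
  also have "adj_mat B0 * E * adj_mat B1 = (adj_mat B0 * B0) * (E * adj_mat B1)"
    using E c a0(1) a1(1) by (subst B0E[symmetric]) (simp add: assoc_mult_mat[of _ n n _ n _ n])
  also have "\<dots> = g0 \<cdot>\<^sub>m (E * adj_mat B1)"
    unfolding a0(3) using e1 by (simp add: g mult_smult_assoc_mat[of _ n n _ n] left_mult_one_mat[OF e1])
  also have "adj_mat B0 * F * adj_mat B1 = (adj_mat B0 * F) * (B1 * adj_mat B1)"
    using F c a0(1) a1(1) by (subst FB1[symmetric]) (simp add: assoc_mult_mat[of _ n n _ n _ n] del: FB1)
  also have "\<dots> = g1 \<cdot>\<^sub>m (adj_mat B0 * F)"
    unfolding a1(2) using e0 by (simp add: g mult_smult_distrib[of _ n n _ n] right_mult_one_mat[OF e0])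
  also have "g0 \<cdot>\<^sub>m (E * adj_mat B1) + g1 \<cdot>\<^sub>m (adj_mat B0 * F)
      = g1 \<cdot>\<^sub>m (adj_mat B0 * F) + g0 \<cdot>\<^sub>m (E * adj_mat B1)"
    using e0 e1 by (intro comm_add_mat[of _ n n]) simp_all
  finally show thesis
    using that[OF M e0 e1 YM] by (simp add: g1_def g0_def F_def)
qed

section \<open>The characteristic polynomial and the rank on the image of an idempotent\<close>

text \<open>
  For \<open>T\<close> commuting with the idempotent \<open>E\<close>, this is the characteristic polynomial of \<open>T\<close> on \<open>im E\<close>.
  For \<open>T = 0\<close> it is Goldman's rank polynomial of \<open>im E\<close>: its coefficient of degree \<open>d\<close> is the
  idempotent that cuts out the part of the spectrum where \<open>im E\<close> has rank \<open>d\<close>.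
\<close>
definition char_poly_on_image :: "'a::comm_ring_1 mat \<Rightarrow> 'a mat \<Rightarrow> 'a poly" where
  "char_poly_on_image E T = det_on_image (map_mat (\<lambda>a. [:a:]) E) (char_poly_matrix T)"

lemma comm_ring_hom_const: "comm_ring_hom (\<lambda>a::'a::comm_ring_1. [:a:])"
  by unfold_locales (auto simp: one_pCons)

lemma comm_ring_hom_map_poly:
  assumes "comm_ring_hom f"
  shows "comm_ring_hom (map_poly f)"
proof -
  interpret f: comm_ring_hom f by (rule assms)
  interpret m: map_poly_comm_ring_hom f ..
  show ?thesis by (rule m.comm_ring_hom_axioms)
qed

lemma poly_char_poly_on_image:
  assumes "E \<in> carrier_mat n n" "T \<in> carrier_mat n n"
  shows "poly (char_poly_on_image E T) a = det_on_image E (a \<cdot>\<^sub>m 1\<^sub>m n - T)"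
proof -
  have E: "map_mat (\<lambda>a. [:a:]) E \<in> carrier_mat n n" using assms by simp
  have "map_mat (\<lambda>p. poly p a) (map_mat (\<lambda>a. [:a:]) E) = E"
    "map_mat (\<lambda>p. poly p a) (char_poly_matrix T) = a \<cdot>\<^sub>m 1\<^sub>m n - T"
    using assms by (auto intro!: eq_matI simp: char_poly_matrix_def)
  then show ?thesis
    using poly_hom.det_on_image_hom[OF E char_poly_matrix_closed[OF assms(2)], of a]
    by (simp add: char_poly_on_image_def)
qed

lemma map_const_idempotent:
  fixes E :: "'a::comm_ring_1 mat"
  assumes "E \<in> carrier_mat n n" "E * E = E"
  shows "map_mat (\<lambda>a. [:a:]) E * map_mat (\<lambda>a. [:a:]) E = map_mat (\<lambda>a. [:a:]) E"
proof -
  interpret comm_ring_hom "\<lambda>a::'a. [:a:]" by (rule comm_ring_hom_const)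
  show ?thesis using mat_hom_mult[OF assms(1,1)] assms(2) by simp
qed

text \<open>The first two facts transport the hypotheses on \<open>E\<close> and \<open>T\<close> to matrices over the polynomial ring.\<close>
lemma char_poly_on_image_split:
  fixes E :: "'a::comm_ring_1 mat"
  assumes E: "E \<in> carrier_mat n n" "E * E = E" and T: "T \<in> carrier_mat n n" "E * T = T * E"
  defines "E' \<equiv> map_mat (\<lambda>a. [:a:]) E"
  shows "E' * char_poly_matrix T = char_poly_matrix T * E'" (is ?c)
    and "map_mat (\<lambda>a. [:a:]) (1\<^sub>m n - E) = 1\<^sub>m n - E'" (is ?d)
    and "char_poly_on_image E T * char_poly_on_image (1\<^sub>m n - E) T = char_poly T"
proof -
  interpret h: comm_ring_hom "\<lambda>a::'a. [:a:]" by (rule comm_ring_hom_const)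
  let ?x = "[:0, 1:] :: 'a poly" and ?T = "map_mat (\<lambda>a. [:a:]) T"
  have E': "E' \<in> carrier_mat n n" "E' * E' = E'"
    using E map_const_idempotent[OF E] by (auto simp: E'_def)
  have T': "?T \<in> carrier_mat n n" using T by simp
  have L: "char_poly_matrix T = ?x \<cdot>\<^sub>m 1\<^sub>m n - ?T"
    using T by (auto intro!: eq_matI simp: char_poly_matrix_def)
  have "E' * ?T = ?T * E'"
    unfolding E'_def using h.mat_hom_mult[OF E(1) T(1)] h.mat_hom_mult[OF T(1) E(1)] T(2) by simp
  moreover have "E' * (?x \<cdot>\<^sub>m 1\<^sub>m n) = ?x \<cdot>\<^sub>m E'" "(?x \<cdot>\<^sub>m 1\<^sub>m n) * E' = ?x \<cdot>\<^sub>m E'"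
    using E' by (simp_all add: mult_smult_distrib[of _ n n _ n] mult_smult_assoc_mat[of _ n n _ n])
  ultimately show c: ?c
    unfolding L using E' T'
    by (simp add: mult_minus_distrib_mat[of _ n n _ n] minus_mult_distrib_mat[of _ n n _ _ n])
  have "[:1 - a:] = 1 - [:a:]" for a :: 'a by (rule poly_eqI) (simp add: coeff_pCons split: nat.split)
  then show d: ?d using E by (auto intro!: eq_matI simp: E'_def)
  show "char_poly_on_image E T * char_poly_on_image (1\<^sub>m n - E) T = char_poly T"
    unfolding char_poly_on_image_def d char_poly_def
    using det_on_image_split[OF E' char_poly_matrix_closed[OF T(1)] c] by (simp add: E'_def)
qed

text \<open>
  On the part of the spectrum where \<open>im E\<close> has rank \<open>d\<close>, the polynomial \<open>g\<close> is monic of degree \<open>d\<close>.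
  The reason is homogeneity. Consider \<open>Q(\<lambda>, z) = det (E (z - \<lambda> T) + (1 - E))\<close>. Substituting
  \<open>z = \<lambda> x\<close> pulls out a factor \<open>\<lambda>\<close> on \<open>im E\<close>, so \<open>Q(\<lambda>, \<lambda> x) = r(\<lambda>) g(x)\<close>, whereas \<open>Q(0, z) = r(z)\<close>.
  In \<open>Q(\<lambda>, \<lambda> x)\<close> a monomial \<open>\<lambda>\<^sup>d x\<^sup>b\<close> occurs only for \<open>b \<le> d\<close>, and for \<open>b = d\<close> its coefficient is
  that of \<open>z\<^sup>d\<close> in \<open>Q(0, z)\<close>.
\<close>
lemma char_poly_on_image_coeff:
  fixes E T :: "'a::comm_ring_1 mat"
  assumes E: "E \<in> carrier_mat n n" "E * E = E" and T: "T \<in> carrier_mat n n"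
  defines "r \<equiv> char_poly_on_image E (0\<^sub>m n n)" and "g \<equiv> char_poly_on_image E T"
  shows "b > d \<Longrightarrow> coeff r d * coeff g b = 0" and "coeff r d * coeff g d = coeff r d"
proof -
  define c :: "'a \<Rightarrow> 'a poly poly" where "c = (\<lambda>a. [:[:a:]:])"
  define z :: "'a poly poly" where "z = [:0, 1:]"
  define l :: "'a poly poly" where "l = [:[:0, 1:]:]"
  note const = comm_ring_hom_const
  have c: "comm_ring_hom c" by unfold_locales (auto simp: c_def one_pCons)
  have cE: "map_mat c E \<in> carrier_mat n n" "map_mat c E * map_mat c E = map_mat c E"
    using E semiring_hom.mat_hom_mult[OF comm_ring_hom.axioms(1)[OF c, THEN ring_hom.axioms(1)] E(1,1)] by auto
  have cT: "map_mat c T \<in> carrier_mat n n" using T by simp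
  define Q where "Q = det_on_image (map_mat c E) (z \<cdot>\<^sub>m 1\<^sub>m n - l \<cdot>\<^sub>m map_mat c T)"
  have Qc: "z \<cdot>\<^sub>m 1\<^sub>m n - l \<cdot>\<^sub>m map_mat c T \<in> carrier_mat n n" using T by auto
  have kE: "map_mat (\<lambda>a. [:a:]) E \<in> carrier_mat n n" using E by simp

  have "Q \<circ>\<^sub>p [:0, [:0, 1:]:] = det_on_image (map_mat c E) ((l * z) \<cdot>\<^sub>m 1\<^sub>m n - l \<cdot>\<^sub>m map_mat c T)"
  proof -
    have "map_mat (\<lambda>p. p \<circ>\<^sub>p [:0, [:0, 1:]:]) (map_mat c E) = map_mat c E"
      "map_mat (\<lambda>p. p \<circ>\<^sub>p [:0, [:0, 1:]:]) (z \<cdot>\<^sub>m 1\<^sub>m n - l \<cdot>\<^sub>m map_mat c T)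
        = (l * z) \<cdot>\<^sub>m 1\<^sub>m n - l \<cdot>\<^sub>m map_mat c T"
      using E T by (auto intro!: eq_matI simp: c_def z_def l_def pcompose_pCons pcompose_diff pcompose_mult)
    then show ?thesis
      using pcompose_hom.det_on_image_hom[OF cE(1) Qc, of "[:0, [:0, 1:]:]"] by (simp add: Q_def)
  qed
  also have "(l * z) \<cdot>\<^sub>m 1\<^sub>m n - l \<cdot>\<^sub>m map_mat c T = (l \<cdot>\<^sub>m 1\<^sub>m n) * (z \<cdot>\<^sub>m 1\<^sub>m n - map_mat c T)"
  proof -
    have "(l \<cdot>\<^sub>m 1\<^sub>m n) * (z \<cdot>\<^sub>m 1\<^sub>m n - map_mat c T) = l \<cdot>\<^sub>m (z \<cdot>\<^sub>m 1\<^sub>m n - map_mat c T)"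
      using minus_carrier_mat[OF cT, of "z \<cdot>\<^sub>m 1\<^sub>m n"]
      by (simp add: mult_smult_assoc_mat[of _ n n _ n] left_mult_one_mat[of _ n n])
    also have "\<dots> = (l * z) \<cdot>\<^sub>m 1\<^sub>m n - l \<cdot>\<^sub>m map_mat c T"
      using T by (auto intro!: eq_matI simp: algebra_simps)
    finally show ?thesis ..
  qed
  also have "det_on_image (map_mat c E) \<dots>
      = det_on_image (map_mat c E) (l \<cdot>\<^sub>m 1\<^sub>m n) * det_on_image (map_mat c E) (z \<cdot>\<^sub>m 1\<^sub>m n - map_mat c T)"
    using cE cT by (intro det_on_image_mult[of _ n])
      (auto simp: mult_smult_distrib[of _ n n _ n] mult_smult_assoc_mat[of _ n n _ n])
  also have "det_on_image (map_mat c E) (l \<cdot>\<^sub>m 1\<^sub>m n) = [:r:]"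
  proof -
    have "map_mat (\<lambda>a. [:a:]) (map_mat (\<lambda>a. [:a:]) E) = map_mat c E"
      "map_mat (\<lambda>a. [:a:]) (char_poly_matrix (0\<^sub>m n n)) = l \<cdot>\<^sub>m 1\<^sub>m n"
      by (auto intro!: eq_matI simp: c_def l_def char_poly_matrix_def)
    then show ?thesis
      using comm_ring_hom.det_on_image_hom[OF const kE char_poly_matrix_closed[of "0\<^sub>m n n" n]]
      by (simp add: r_def char_poly_on_image_def)
  qed
  also have "det_on_image (map_mat c E) (z \<cdot>\<^sub>m 1\<^sub>m n - map_mat c T) = map_poly (\<lambda>a. [:a:]) g"
  proof -
    have "map_mat (map_poly (\<lambda>a. [:a:])) (map_mat (\<lambda>a. [:a:]) E) = map_mat c E"
      "map_mat (map_poly (\<lambda>a. [:a:])) (char_poly_matrix T) = z \<cdot>\<^sub>m 1\<^sub>m n - map_mat c T"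
      using T by (auto intro!: eq_matI simp: c_def z_def char_poly_matrix_def Polynomial.map_poly_pCons)
    then show ?thesis
      using comm_ring_hom.det_on_image_hom[OF comm_ring_hom_map_poly[OF const] kE char_poly_matrix_closed[OF T]]
      by (simp add: g_def char_poly_on_image_def)
  qed
  finally have Q1: "Q \<circ>\<^sub>p [:0, [:0, 1:]:] = [:r:] * map_poly (\<lambda>a. [:a:]) g" .

  have Q0: "map_poly (\<lambda>p. poly p 0) Q = r"
  proof -
    have "map_mat (map_poly (\<lambda>p. poly p 0)) (map_mat c E) = map_mat (\<lambda>a. [:a:]) E"
      "map_mat (map_poly (\<lambda>p. poly p 0)) (z \<cdot>\<^sub>m 1\<^sub>m n - l \<cdot>\<^sub>m map_mat c T) = char_poly_matrix (0\<^sub>m n n)"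
      using T by (auto intro!: eq_matI simp: c_def z_def l_def char_poly_matrix_def Polynomial.map_poly_pCons)
    note eqs = this
    have "comm_ring_hom (\<lambda>p::'a poly. poly p 0)" by (rule poly_hom.comm_ring_hom_axioms)
    from comm_ring_hom.det_on_image_hom[OF comm_ring_hom_map_poly[OF this] cE(1) Qc]
    show ?thesis unfolding eqs Q_def r_def char_poly_on_image_def by (rule sym)
  qed

  have key: "coeff r d * coeff g b = (if d < b then 0 else coeff (coeff Q b) (d - b))" for b d
  proof -
    have "coeff r d * coeff g b = coeff (coeff ([:r:] * map_poly (\<lambda>a. [:a:]) g) b) d"
      by (simp add: coeff_map_poly mult.commute)
    also have "\<dots> = coeff ([:0, 1:] ^ b * coeff Q b) d"
      unfolding Q1[symmetric] by (simp add: coeff_pcompose_linear)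
    also have "[:0, 1:] ^ b = (monom 1 b :: 'a poly)" by (simp add: monom_altdef)
    finally show ?thesis by (simp add: coeff_monom_mult)
  qed
  show "coeff r d * coeff g b = 0" if "b > d" using that by (simp add: key)
  have "coeff r d = coeff (coeff Q d) 0"
    unfolding Q0[symmetric] by (simp add: coeff_map_poly poly_0_coeff_0)
  then show "coeff r d * coeff g d = coeff r d" using key[of d d] by simp
qed

text \<open>
  Both orthogonality and idempotency are the case \<open>T = 0\<close> of the preceding lemma, and the sum of the
  coefficients is the value at 1, that is, the determinant of the identity.
\<close>
lemma rank_idempotents:
  fixes E :: "'a::comm_ring_1 mat"
  assumes E: "E \<in> carrier_mat n n" "E * E = E"
  defines "r \<equiv> char_poly_on_image E (0\<^sub>m n n)"
  shows "coeff r d * coeff r d = coeff r d"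
    and "complete_orthogonal_idempotents (coeff r ` {..degree r})"
proof -
  have zero_closed: "0\<^sub>m n n \<in> carrier_mat n n" by simp
  show i: "coeff r d * coeff r d = coeff r d" for d
    unfolding r_def by (rule char_poly_on_image_coeff(2)[OF E zero_closed])
  have gt: "b > d \<Longrightarrow> coeff r d * coeff r b = 0" for b d
    unfolding r_def by (rule char_poly_on_image_coeff(1)[OF E zero_closed])
  have ortho: "b \<noteq> d \<Longrightarrow> coeff r d * coeff r b = 0" for b d
    using gt[of d b] gt[of b d] by (cases "d < b") (auto simp: mult.commute)
  have "1 \<cdot>\<^sub>m 1\<^sub>m n - 0\<^sub>m n n = (1\<^sub>m n :: 'a mat)" by (auto intro!: eq_matI)
  then have "poly r 1 = 1"
    unfolding r_def poly_char_poly_on_image[OF E(1) zero_closed] by (simp add: det_on_image_one[OF E])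
  then have "(\<Sum>d\<le>degree r. coeff r d) = 1" by (simp add: poly_altdef)
  moreover have "\<Sum>(coeff r ` {..degree r}) = (\<Sum>d\<le>degree r. coeff r d)"
  proof -
    have zero: "coeff r d = 0" if "d \<noteq> b" "coeff r d = coeff r b" for b d
      using ortho[of b d] i[of d] that by simp
    show ?thesis
    proof (subst sum.reindex_nontrivial)
      fix b d assume "b \<noteq> d" "coeff r b = coeff r d"
      then show "coeff r b = 0" by (rule zero)
    qed simp_all
  qed
  ultimately have sum: "\<Sum>(coeff r ` {..degree r}) = 1" by (rule trans[rotated])
  show "complete_orthogonal_idempotents (coeff r ` {..degree r})"
    unfolding complete_orthogonal_idempotents_def
  proof (intro conjI ballI impI)
    show "finite (coeff r ` {..degree r})" by simp
    show "\<Sum>(coeff r ` {..degree r}) = 1" by (rule sum)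
    fix e assume "e \<in> coeff r ` {..degree r}"
    then obtain d where e: "e = coeff r d" by (rule imageE)
    show "e * e = e" unfolding e by (rule i)
    fix f assume "f \<in> coeff r ` {..degree r}" and ne: "e \<noteq> f"
    then obtain b where f: "f = coeff r b" by (meson imageE)
    show "e * f = 0" unfolding e f by (rule ortho) (use ne e f in auto)
  qed
qed

section \<open>Companion matrices\<close>

lemma monic_mult_cancel:
  fixes h :: "'a::comm_ring_1 poly"
  assumes "monic h" "h * p = h * q"
  shows "p = q"
proof (rule ccontr)
  assume "p \<noteq> q"
  then have "lead_coeff (p - q) \<noteq> 0" by (simp del: coeff_diff)
  then have "coeff (h * (p - q)) (degree h + degree (p - q)) \<noteq> 0"
    using assms(1) by (simp add: coeff_mult_degree_sum del: coeff_diff)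
  moreover have "h * (p - q) = 0" using assms(2) by (simp add: algebra_simps)
  ultimately show False by simp
qed

lemma companion_matrix_closed [simp]: "companion_matrix h \<in> carrier_mat (degree h) (degree h)"
  by (simp add: companion_matrix_def)

text \<open>
  The row \<open>(1, t, \<dots>, t\<^sup>n\<^sup>-\<^sup>1)\<close> is a left eigenvector of the companion matrix modulo \<open>h\<close>; multiplied by
  \<open>t - C\<^sub>h\<close> it gives \<open>(0, \<dots>, 0, h)\<close>.
\<close>
lemma powers_mult_companion:
  fixes h :: "'a::comm_ring_1 poly"
  assumes h: "monic h" and j: "j < degree h"
  shows "(\<Sum>i<degree h. monom 1 i * char_poly_matrix (companion_matrix h) $$ (i, j))
    = (if Suc j = degree h then h else 0)"
proof -
  let ?n = "degree h"
  let ?L = "char_poly_matrix (companion_matrix h)"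
  have L: "?L $$ (i, j) = (if i = j then [:0, 1:] else 0) - [:companion_matrix h $$ (i, j):]"
    if "i < ?n" for i
    using that j by (auto simp: char_poly_matrix_def companion_matrix_def)
  have C: "companion_matrix h $$ (i, j) = (if Suc j = ?n then - coeff h i else if i = Suc j then 1 else 0)"
    if "i < ?n" for i
    using that j by (simp add: companion_matrix_def)
  have const: "monom 1 i * [:c:] = monom c i" for i and c :: 'a
    by (simp add: mult.commute[of _ "[:c:]"] smult_monom)
  have X: "(monom 1 i * [:0, 1:] :: 'a poly) = monom 1 (Suc i)" for i
    by (simp add: monom_Suc mult.commute[of _ "[:0, 1:]"])
  show ?thesis
  proof (cases "Suc j = ?n")
    case True
    have "(\<Sum>i<?n. monom 1 i * ?L $$ (i, j))
        = (\<Sum>i<?n. (if i = j then monom 1 (Suc i) else 0) + monom (coeff h i) i)"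
    proof (intro sum.cong refl)
      fix i assume "i \<in> {..<?n}"
      then show "monom 1 i * ?L $$ (i, j)
          = (if i = j then monom 1 (Suc i) else 0) + monom (coeff h i) i"
        using True j by (simp add: L C right_diff_distrib X const minus_monom[symmetric] del: mult_pCons_right)
    qed
    also have "\<dots> = monom 1 ?n + (\<Sum>i<?n. monom (coeff h i) i)"
      using True j by (simp add: sum.distrib)
    also have "\<dots> = (\<Sum>i\<le>?n. monom (coeff h i) i)"
      using h by (simp add: lessThan_Suc_atMost[symmetric])
    also have "\<dots> = h" by (rule poly_as_sum_of_monoms)
    finally show ?thesis using True by simp
  next
    case False
    have "(\<Sum>i<?n. monom 1 i * ?L $$ (i, j))
        = (\<Sum>i<?n. (if i = j then monom 1 (Suc i) else 0) - (if i = Suc j then monom 1 i else 0))"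
      using False j by (intro sum.cong refl) (simp add: L C right_diff_distrib X const del: mult_pCons_right)
    also have "\<dots> = 0" using False j by (simp add: sum_subtractf)
    finally show ?thesis using False by simp
  qed
qed

text \<open>
  Multiply the equation for \<open>M\<close> on the left by the row of powers of \<open>t\<close>. Without
  any expansion of minors this yields the characteristic polynomial of \<open>C\<^sub>h\<close>, and it shows that a
  matrix which behaves like the adjugate has 1 as its lower left entry.
\<close>
lemma companion_adjugate_last_row:
  fixes h :: "'a::comm_ring_1 poly"
  assumes h: "monic h" and M: "M \<in> carrier_mat (degree h) (degree h)"
    and LM: "char_poly_matrix (companion_matrix h) * M = c \<cdot>\<^sub>m 1\<^sub>m (degree h)"
    and k: "k < degree h"
  shows "c * monom 1 k = h * M $$ (degree h - 1, k)"
proof -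
  let ?n = "degree h"
  let ?L = "char_poly_matrix (companion_matrix h)"
  have L: "?L \<in> carrier_mat ?n ?n" by simp
  have "c * monom 1 k = (\<Sum>i<?n. monom 1 i * (c \<cdot>\<^sub>m 1\<^sub>m ?n) $$ (i, k))"
    using k by (simp add: if_distrib mult.commute cong: if_cong)
  also have "\<dots> = (\<Sum>i<?n. monom 1 i * (\<Sum>j<?n. ?L $$ (i, j) * M $$ (j, k)))"
    unfolding LM[symmetric] using carrier_matD[OF L] M k
    by (intro sum.cong refl) (simp add: scalar_prod_def atLeast0LessThan)
  also have "\<dots> = (\<Sum>j<?n. (\<Sum>i<?n. monom 1 i * ?L $$ (i, j)) * M $$ (j, k))"
    unfolding sum_distrib_left sum_distrib_right by (subst sum.swap) (simp add: mult.assoc)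
  also have "\<dots> = (\<Sum>j<?n. if j = ?n - 1 then h * M $$ (j, k) else 0)"
    using k by (intro sum.cong refl) (auto simp: powers_mult_companion[OF h])
  also have "\<dots> = h * M $$ (?n - 1, k)"
    using k by simp
  finally show ?thesis .
qed

text \<open>
  The previous lemma with \<open>k = 0\<close>, applied to the adjugate, shows that \<open>h\<close> divides the
  characteristic polynomial; both are monic of the same degree.
\<close>
lemma char_poly_companion:
  fixes h :: "'a::comm_ring_1 poly"
  assumes h: "monic h" and n: "degree h > 0"
  shows "char_poly (companion_matrix h) = h"
proof -
  let ?n = "degree h" and ?C = "companion_matrix h"
  let ?q = "adj_mat (char_poly_matrix ?C) $$ (?n - 1, 0)"
  have L: "char_poly_matrix ?C \<in> carrier_mat ?n ?n" by simp
  have hq: "char_poly ?C = h * ?q"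
    using companion_adjugate_last_row[OF h adj_mat(1,2)[OF L] n] by (simp add: char_poly_def)
  have C: "degree (char_poly ?C) = ?n" "monic (char_poly ?C)"
    using degree_monic_char_poly[OF companion_matrix_closed[of h]] by auto
  have "?q \<noteq> 0" using C hq by auto
  then have "coeff (h * ?q) (?n + degree ?q) \<noteq> 0"
    using h by (simp add: coeff_mult_degree_sum)
  then have "?n + degree ?q \<le> ?n" unfolding hq[symmetric] using C(1) le_degree by metis
  then obtain a where q: "?q = [:a:]" by (auto elim: degree_eq_zeroE)
  have "coeff (h * ?q) ?n = a" unfolding q using h by simp
  then have "a = 1" unfolding hq[symmetric] using C by simp
  with hq q show ?thesis by simp
qed

section \<open>Evaluation of polynomials at matrices\<close>

definition mat_poly :: "'a::comm_ring_1 mat \<Rightarrow> 'a poly \<Rightarrow> 'a mat" where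
  "mat_poly A f = fold_coeffs (\<lambda>a M. a \<cdot>\<^sub>m 1\<^sub>m (dim_row A) + A * M) f (0\<^sub>m (dim_row A) (dim_row A))"

context
  fixes A :: "'a::comm_ring_1 mat" and n
  assumes A: "A \<in> carrier_mat n n"
begin

lemma mat_poly_0: "mat_poly A 0 = 0\<^sub>m n n"
  using A by (simp add: mat_poly_def)

lemma mat_poly_pCons: "mat_poly A (pCons a f) = a \<cdot>\<^sub>m 1\<^sub>m n + A * mat_poly A f"
proof (cases "f = 0 \<and> a = 0")
  case True
  then show ?thesis using A by (auto simp: mat_poly_0)
next
  case False
  then show ?thesis using A by (auto simp: mat_poly_def)
qed

lemma mat_poly_closed: "mat_poly A f \<in> carrier_mat n n"
  using A by (induction f) (auto simp: mat_poly_0 mat_poly_pCons)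

lemma mat_poly_const: "mat_poly A [:a:] = a \<cdot>\<^sub>m 1\<^sub>m n"
  using A by (simp add: mat_poly_pCons mat_poly_0)

lemma mat_poly_one: "mat_poly A 1 = 1\<^sub>m n"
  by (simp add: one_pCons mat_poly_const) (auto intro!: eq_matI)

lemma mat_poly_X: "mat_poly A [:0, 1:] = A"
proof -
  have "mat_poly A [:0, 1:] = 0 \<cdot>\<^sub>m 1\<^sub>m n + A * (1 \<cdot>\<^sub>m 1\<^sub>m n)"
    by (simp only: mat_poly_pCons[of 0] mat_poly_const)
  also have "1 \<cdot>\<^sub>m 1\<^sub>m n = (1\<^sub>m n :: 'a mat)" by (auto intro!: eq_matI)
  finally show ?thesis using A by (auto intro!: eq_matI)
qed

lemma mat_poly_add: "mat_poly A (f + g) = mat_poly A f + mat_poly A g"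
proof (induction f g rule: poly_induct2)
  case 0
  show ?case by (simp add: mat_poly_0)
next
  case (pCons a f b g)
  have "A * mat_poly A (f + g) = A * mat_poly A f + A * mat_poly A g"
    unfolding pCons using A mat_poly_closed by (intro mult_add_distrib_mat) auto
  moreover have "(a + b) \<cdot>\<^sub>m 1\<^sub>m n + (M + N) = (a \<cdot>\<^sub>m 1\<^sub>m n + M) + (b \<cdot>\<^sub>m 1\<^sub>m n + N)"
    if "M \<in> carrier_mat n n" "N \<in> carrier_mat n n" for M N :: "'a mat"
    using that by (auto intro!: eq_matI simp: algebra_simps)
  ultimately show ?case using A mat_poly_closed by (simp add: mat_poly_pCons)
qed

lemma mat_poly_smult: "mat_poly A (Polynomial.smult c f) = c \<cdot>\<^sub>m mat_poly A f"
proof (induction f)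
  case 0
  show ?case by (auto simp: mat_poly_0)
next
  case (pCons a f)
  have "A * (c \<cdot>\<^sub>m mat_poly A f) = c \<cdot>\<^sub>m (A * mat_poly A f)"
    using A mat_poly_closed by (rule mult_smult_distrib)
  moreover have "(c * a) \<cdot>\<^sub>m 1\<^sub>m n + c \<cdot>\<^sub>m M = c \<cdot>\<^sub>m (a \<cdot>\<^sub>m 1\<^sub>m n + M)"
    if "M \<in> carrier_mat n n" for M :: "'a mat"
    using that by (auto intro!: eq_matI simp: algebra_simps)
  ultimately show ?case using A mat_poly_closed by (simp add: mat_poly_pCons pCons)
qed

lemma mat_poly_mult: "mat_poly A (f * g) = mat_poly A f * mat_poly A g"
proof (induction f)
  case 0
  show ?case using mat_poly_closed[of g] by (simp add: mat_poly_0)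
next
  case (pCons a f)
  note c = mat_poly_closed[of f] mat_poly_closed[of g]
  have "mat_poly A (pCons a f * g)
      = a \<cdot>\<^sub>m mat_poly A g + (0 \<cdot>\<^sub>m 1\<^sub>m n + A * (mat_poly A f * mat_poly A g))"
    by (simp only: mult_pCons_left mat_poly_add mat_poly_smult mat_poly_pCons pCons)
  also have "\<dots> = (a \<cdot>\<^sub>m 1\<^sub>m n) * mat_poly A g + (A * mat_poly A f) * mat_poly A g"
  proof -
    have "(a \<cdot>\<^sub>m 1\<^sub>m n) * mat_poly A g = a \<cdot>\<^sub>m mat_poly A g"
      using c by (simp add: mult_smult_assoc_mat[of _ n n _ n])
    moreover have "0 \<cdot>\<^sub>m 1\<^sub>m n + A * (mat_poly A f * mat_poly A g) = (A * mat_poly A f) * mat_poly A g"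
      using A c by (auto simp: assoc_mult_mat[of _ n n _ n _ n])
    ultimately show ?thesis by simp
  qed
  also have "\<dots> = mat_poly A (pCons a f) * mat_poly A g"
    unfolding mat_poly_pCons using A c by (intro add_mult_distrib_mat[symmetric]) auto
  finally show ?case .
qed

text \<open>
  The remainder theorem over the matrix ring: \<open>t - A\<close> divides \<open>f(t) - f(A)\<close> on the left. Together with
  \<open>(t - A) adj (t - A) = \<chi>(A)\<close> it shows that \<open>t - A\<close> divides, on the left, the constant matrix which
  is the value of \<open>\<chi>(A)\<close> at \<open>A\<close>. The lemma after it says that such a constant vanishes.
\<close>
lemma char_poly_matrix_dvd_diff:
  "\<exists>K \<in> carrier_mat n n. f \<cdot>\<^sub>m 1\<^sub>m n = char_poly_matrix A * K + map_mat (\<lambda>a. [:a:]) (mat_poly A f)"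
proof (induction f)
  case 0
  have "char_poly_matrix A * 0\<^sub>m n n = 0\<^sub>m n n"
    using char_poly_matrix_closed[OF A] by (rule right_mult_zero_mat)
  then show ?case
    by (intro bexI[of _ "0\<^sub>m n n"]) (auto intro!: eq_matI simp: mat_poly_0)
next
  case (pCons a f)
  define c :: "'a mat \<Rightarrow> 'a poly mat" where "c = map_mat (\<lambda>a. [:a:])"
  define L where "L = char_poly_matrix A"
  define P where "P = mat_poly A f"
  interpret h: comm_ring_hom "\<lambda>a::'a. [:a:]" by unfold_locales (auto simp: one_pCons)
  have L: "L \<in> carrier_mat n n" using A by (simp add: L_def)
  have P: "P \<in> carrier_mat n n" by (simp add: P_def mat_poly_closed)
  have cc: "c B \<in> carrier_mat n n" if "B \<in> carrier_mat n n" for B using that by (simp add: c_def)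
  obtain K where K: "K \<in> carrier_mat n n" "f \<cdot>\<^sub>m 1\<^sub>m n = L * K + c P"
    using pCons by (auto simp: c_def L_def P_def)
  define t :: "'a poly" where "t = [:0, 1:]"
  have tL: "t \<cdot>\<^sub>m 1\<^sub>m n = L + c A"
    using A by (auto intro!: eq_matI simp: t_def L_def c_def char_poly_matrix_def)
  have tP: "t \<cdot>\<^sub>m c P = L * c P + c A * c P"
  proof -
    have "t \<cdot>\<^sub>m c P = (t \<cdot>\<^sub>m 1\<^sub>m n) * c P" using cc[OF P]
      by (simp add: mult_smult_assoc_mat[of _ n n _ n])
    also have "\<dots> = L * c P + c A * c P"
      unfolding tL using L cc[OF A] cc[OF P] by (rule add_mult_distrib_mat)
    finally show ?thesis .
  qed
  have cAP: "c (A * P) = c A * c P" unfolding c_def using A P by (rule h.mat_hom_mult)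
  have LtK: "L * (t \<cdot>\<^sub>m K + c P) = t \<cdot>\<^sub>m (L * K) + L * c P"
    using L K(1) cc[OF P] by (simp add: mult_add_distrib_mat[of _ n n _ n] mult_smult_distrib[of _ n n _ n])
  have t_expand: "pCons a f \<cdot>\<^sub>m 1\<^sub>m n = c (a \<cdot>\<^sub>m 1\<^sub>m n) + t \<cdot>\<^sub>m (f \<cdot>\<^sub>m 1\<^sub>m n)"
    by (auto intro!: eq_matI simp: c_def t_def)
  have carr: "L * K \<in> carrier_mat n n" "L * c P \<in> carrier_mat n n" "c A * c P \<in> carrier_mat n n"
    "c (a \<cdot>\<^sub>m 1\<^sub>m n) \<in> carrier_mat n n"
    using mult_carrier_mat[OF L K(1)] mult_carrier_mat[OF L cc[OF P]]
      mult_carrier_mat[OF cc[OF A] cc[OF P]] cc[of "a \<cdot>\<^sub>m 1\<^sub>m n"] by auto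
  have "pCons a f \<cdot>\<^sub>m 1\<^sub>m n = c (a \<cdot>\<^sub>m 1\<^sub>m n) + (t \<cdot>\<^sub>m (L * K) + (L * c P + c A * c P))"
    unfolding t_expand K(2) tP[symmetric] using carr cc[OF P]
    by (simp add: add_smult_distrib_left_mat[of _ n n])
  also have "\<dots> = L * (t \<cdot>\<^sub>m K + c P) + (c (a \<cdot>\<^sub>m 1\<^sub>m n) + c (A * P))"
  proof -
    have "M1 + (t \<cdot>\<^sub>m M2 + (M3 + M4)) = (t \<cdot>\<^sub>m M2 + M3) + (M1 + M4)"
      if "M1 \<in> carrier_mat n n" "M2 \<in> carrier_mat n n" "M3 \<in> carrier_mat n n" "M4 \<in> carrier_mat n n"
      for M1 M2 M3 M4 :: "'a poly mat"
      using that by (auto intro!: eq_matI simp: algebra_simps)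
    from this[OF carr(4,1-3)] show ?thesis unfolding LtK cAP .
  qed
  also have "c (a \<cdot>\<^sub>m 1\<^sub>m n) + c (A * P) = c (mat_poly A (pCons a f))"
    unfolding mat_poly_pCons P_def[symmetric] using A P by (auto intro!: eq_matI simp: c_def)
  finally have "pCons a f \<cdot>\<^sub>m 1\<^sub>m n = L * (t \<cdot>\<^sub>m K + c P) + c (mat_poly A (pCons a f))" .
  moreover have "t \<cdot>\<^sub>m K + c P \<in> carrier_mat n n" using K(1) cc[OF P] by simp
  ultimately show ?case unfolding L_def c_def by blast
qed

text \<open>
  Comparing coefficients in \<open>(t - A) D = B\<close> expresses the coefficient of degree \<open>k\<close> of \<open>D\<close> by the one of
  degree \<open>k + 1\<close>; since the degrees are bounded, all of them are zero by downward induction.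
\<close>
lemma char_poly_matrix_mult_const:
  assumes D: "D \<in> carrier_mat n n" and B: "B \<in> carrier_mat n n"
    and LD: "char_poly_matrix A * D = map_mat (\<lambda>a. [:a:]) B"
  shows "B = 0\<^sub>m n n"
proof -
  let ?L = "char_poly_matrix A"
  have L: "?L \<in> carrier_mat n n" using A by simp
  have entry: "[:B $$ (i, j):] = [:0, 1:] * D $$ (i, j) - (\<Sum>l<n. Polynomial.smult (A $$ (i, l)) (D $$ (l, j)))"
    if ij: "i < n" "j < n" for i j
  proof -
    have "[:B $$ (i, j):] = (?L * D) $$ (i, j)"
      unfolding LD using B ij by simp
    also have "\<dots> = (\<Sum>l<n. ?L $$ (i, l) * D $$ (l, j))"
      using carrier_matD[OF L] D ij by (simp add: scalar_prod_def atLeast0LessThan)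
    also have "\<dots> = (\<Sum>l<n. (if l = i then [:0, 1:] * D $$ (l, j) else 0) - Polynomial.smult (A $$ (i, l)) (D $$ (l, j)))"
      using A ij by (intro sum.cong refl) (auto simp: char_poly_matrix_def algebra_simps)
    finally show ?thesis using ij by (simp add: sum_subtractf)
  qed
  have rec: "coeff (D $$ (i, j)) k = (\<Sum>l<n. A $$ (i, l) * coeff (D $$ (l, j)) (Suc k))"
    if ij: "i < n" "j < n" for i j k
    using arg_cong[OF entry[OF ij], of "\<lambda>p. coeff p (Suc k)"]
    by (simp add: coeff_sum)
  \<comment> \<open>a common degree bound starts the downward induction\<close>
  obtain N where N: "\<And>i j. i < n \<Longrightarrow> j < n \<Longrightarrow> degree (D $$ (i, j)) < N"
  proof
    fix i j assume "i < n" "j < n"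
    then show "degree (D $$ (i, j)) < Suc (Max ((\<lambda>(i, j). degree (D $$ (i, j))) ` ({..<n} \<times> {..<n})))"
      by (intro le_imp_less_Suc Max_ge) auto
  qed
  have zero: "coeff (D $$ (i, j)) k = 0" if "i < n" "j < n" "k + m \<ge> N" for i j k m
    using that
  proof (induction m arbitrary: i j k)
    case 0
    then show ?case using N[of i j] by (intro coeff_eq_0) auto
  next
    case (Suc m)
    then show ?case by (subst rec) (auto intro!: sum.neutral)
  qed
  have "D $$ (i, j) = 0" if "i < n" "j < n" for i j
    using zero[OF that, of _ N] by (intro poly_eqI) simp
  then have "[:B $$ (i, j):] = 0" if "i < n" "j < n" for i j
    using that by (simp add: entry)
  then show ?thesis using B by (auto intro!: eq_matI)
qed

lemma cayley_hamilton: "mat_poly A (char_poly A) = 0\<^sub>m n n"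
proof -
  let ?L = "char_poly_matrix A" and ?c = "map_mat (\<lambda>a::'a. [:a:])"
  let ?P = "mat_poly A (char_poly A)"
  have L: "?L \<in> carrier_mat n n" using A by simp
  obtain K where K: "K \<in> carrier_mat n n" "char_poly A \<cdot>\<^sub>m 1\<^sub>m n = ?L * K + ?c ?P"
    using char_poly_matrix_dvd_diff by blast
  have "?L * (adj_mat ?L - K) = ?L * adj_mat ?L - ?L * K"
    using L adj_mat(1)[OF L] K(1) by (rule mult_minus_distrib_mat)
  also have "\<dots> = (?L * K + ?c ?P) - ?L * K"
    using K(2) by (simp add: adj_mat(2)[OF L] char_poly_def)
  also have "\<dots> = ?c ?P"
  proof -
    have "(M + N) - M = N" if "M \<in> carrier_mat n n" "N \<in> carrier_mat n n" for M N :: "'a poly mat"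
      using that by (auto intro!: eq_matI)
    then show ?thesis
      using mult_carrier_mat[OF L K(1)] mat_poly_closed[of "char_poly A"] by simp
  qed
  finally have "?L * (adj_mat ?L - K) = ?c ?P" .
  then show ?thesis
    using K(1) adj_mat(1)[OF L] mat_poly_closed
    by (intro char_poly_matrix_mult_const[of "adj_mat ?L - K"]) auto
qed

lemma mat_poly_char_poly_dvd:
  assumes "char_poly A dvd f"
  shows "mat_poly A f = 0\<^sub>m n n"
proof -
  obtain q where "f = char_poly A * q" using assms by (elim dvdE)
  then show ?thesis using mat_poly_closed[of q] by (simp add: mat_poly_mult cayley_hamilton)
qed

end

section \<open>Polynomials over the corners of a commutative ring\<close>

lemma corner_ring_carrier_iff:
  "e * e = e \<Longrightarrow> x \<in> carrier (corner_ring e) \<longleftrightarrow> e * x = x"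
  by (auto simp: corner_ring_def mult.assoc[symmetric]) (metis rangeI)

lemma corner_poly_ring_carrier_iff:
  "e * e = e \<Longrightarrow> f \<in> carrier (corner_poly_ring e) \<longleftrightarrow> Polynomial.smult e f = f"
  by (simp add: corner_poly_ring_def corner_ring_carrier_iff poly_eq_iff)

lemma cring_corner_poly_ring:
  assumes "e * e = e"
  shows "cring (corner_poly_ring e)"
proof (rule cringI)
  note iff = corner_poly_ring_carrier_iff[OF assms]
  have ops: "a \<oplus>\<^bsub>corner_poly_ring e\<^esub> b = a + b" "a \<otimes>\<^bsub>corner_poly_ring e\<^esub> b = a * b"
    "\<one>\<^bsub>corner_poly_ring e\<^esub> = [:e:]" "\<zero>\<^bsub>corner_poly_ring e\<^esub> = 0" for a b
    by (simp_all add: corner_poly_ring_def)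
  show "abelian_group (corner_poly_ring e)"
  proof (rule abelian_groupI)
    fix x assume "x \<in> carrier (corner_poly_ring e)"
    then show "\<exists>y\<in>carrier (corner_poly_ring e). y \<oplus>\<^bsub>corner_poly_ring e\<^esub> x = \<zero>\<^bsub>corner_poly_ring e\<^esub>"
      by (intro bexI[of _ "- x"]) (simp_all add: iff ops)
  qed (auto simp: iff ops smult_add_right add_ac)
  show "comm_monoid (corner_poly_ring e)"
    by (rule comm_monoidI) (auto simp: iff ops assms mult_ac mult_smult_left[symmetric])
qed (simp add: corner_poly_ring_def distrib_right)

text \<open>
  The coefficients \<open>u\<close>, \<open>v\<close> may be taken in the whole polynomial ring: multiplying them by \<open>e\<close> moves
  them into the corner without changing the equation.
\<close>
lemma corner_comaximal_iff:
  fixes e :: "'a::comm_ring_1"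
  assumes e: "e * e = e" and f: "Polynomial.smult e f\<^sub>0 = f\<^sub>0" "Polynomial.smult e f\<^sub>1 = f\<^sub>1"
  shows "Idl\<^bsub>corner_poly_ring e\<^esub> {f\<^sub>0, f\<^sub>1} = carrier (corner_poly_ring e)
    \<longleftrightarrow> (\<exists>u v. f\<^sub>0 * u + f\<^sub>1 * v = [:e:])"
proof -
  let ?R = "corner_poly_ring e"
  interpret R: cring ?R by (rule cring_corner_poly_ring[OF e])
  note iff = corner_poly_ring_carrier_iff[OF e]
  have ops: "a \<oplus>\<^bsub>?R\<^esub> b = a + b" "a \<otimes>\<^bsub>?R\<^esub> b = a * b"
    "\<one>\<^bsub>?R\<^esub> = [:e:]" "\<zero>\<^bsub>?R\<^esub> = 0" for a b
    by (simp_all add: corner_poly_ring_def)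
  have c: "f\<^sub>0 \<in> carrier ?R" "f\<^sub>1 \<in> carrier ?R" using f by (simp_all add: iff)
  show ?thesis
  proof
    assume "Idl\<^bsub>?R\<^esub> {f\<^sub>0, f\<^sub>1} = carrier ?R"
    then have one: "[:e:] \<in> Idl\<^bsub>?R\<^esub> {f\<^sub>0, f\<^sub>1}" by (metis R.one_closed ops(3))
    let ?J = "PIdl\<^bsub>?R\<^esub> f\<^sub>0 <+>\<^bsub>?R\<^esub> PIdl\<^bsub>?R\<^esub> f\<^sub>1"
    have J: "ideal ?J ?R" using c by (intro R.add_ideals R.cgenideal_ideal)
    have "f\<^sub>0 \<in> ?J" "f\<^sub>1 \<in> ?J"
      using c R.cgenideal_self[OF c(1)] R.cgenideal_self[OF c(2)]
        additive_subgroup.zero_closed[OF ideal.axioms(1)[OF R.cgenideal_ideal[OF c(1)]]]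
        additive_subgroup.zero_closed[OF ideal.axioms(1)[OF R.cgenideal_ideal[OF c(2)]]]
      by (force simp: set_add_def' ops)+
    then have "{f\<^sub>0, f\<^sub>1} \<subseteq> ?J" by simp
    from R.genideal_minimal[OF J this] one have "[:e:] \<in> ?J" by (rule subsetD)
    then obtain p q where pq: "p \<in> PIdl\<^bsub>?R\<^esub> f\<^sub>0" "q \<in> PIdl\<^bsub>?R\<^esub> f\<^sub>1" "[:e:] = p + q"
      by (auto simp: set_add_def' ops)
    then obtain u v where "p = u * f\<^sub>0" "q = v * f\<^sub>1" by (auto simp: cgenideal_def ops)
    with pq(3) have "f\<^sub>0 * u + f\<^sub>1 * v = [:e:]" by (simp add: mult.commute)
    then show "\<exists>u v. f\<^sub>0 * u + f\<^sub>1 * v = [:e:]" by blast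
  next
    assume "\<exists>u v. f\<^sub>0 * u + f\<^sub>1 * v = [:e:]"
    then obtain u v where uv: "f\<^sub>0 * u + f\<^sub>1 * v = [:e:]" by blast
    have I: "ideal (Idl\<^bsub>?R\<^esub> {f\<^sub>0, f\<^sub>1}) ?R" using c by (intro R.genideal_ideal) simp
    have mem: "f\<^sub>0 \<in> Idl\<^bsub>?R\<^esub> {f\<^sub>0, f\<^sub>1}" "f\<^sub>1 \<in> Idl\<^bsub>?R\<^esub> {f\<^sub>0, f\<^sub>1}"
      using R.genideal_self[of "{f\<^sub>0, f\<^sub>1}"] c by auto
    have ce: "Polynomial.smult e x \<in> carrier ?R" for x by (simp add: iff e)
    have "f\<^sub>0 * Polynomial.smult e u \<in> Idl\<^bsub>?R\<^esub> {f\<^sub>0, f\<^sub>1}" "f\<^sub>1 * Polynomial.smult e v \<in> Idl\<^bsub>?R\<^esub> {f\<^sub>0, f\<^sub>1}"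
      using ideal.I_r_closed[OF I mem(1) ce[of u]] ideal.I_r_closed[OF I mem(2) ce[of v]]
      by (simp_all only: ops)
    from additive_subgroup.a_closed[OF ideal.axioms(1)[OF I] this]
    have "f\<^sub>0 * Polynomial.smult e u + f\<^sub>1 * Polynomial.smult e v \<in> Idl\<^bsub>?R\<^esub> {f\<^sub>0, f\<^sub>1}"
      by (simp only: ops)
    moreover have "f\<^sub>0 * Polynomial.smult e u + f\<^sub>1 * Polynomial.smult e v = \<one>\<^bsub>?R\<^esub>"
    proof -
      have "f\<^sub>0 * Polynomial.smult e u + f\<^sub>1 * Polynomial.smult e v = Polynomial.smult e (f\<^sub>0 * u + f\<^sub>1 * v)"
        by (simp add: smult_add_right)
      then show ?thesis by (simp add: uv e ops)
    qed
    ultimately show "Idl\<^bsub>?R\<^esub> {f\<^sub>0, f\<^sub>1} = carrier ?R"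
      using ideal.one_imp_carrier[OF I] by simp
  qed
qed

text \<open>Inside the corner, the value at the identity \<open>e\<close> is the \<open>e\<close>-component of the value at 1.\<close>
lemma corner_poly_eval:
  fixes e :: "'a::comm_ring_1"
  assumes "e * e = e"
  shows "e * poly f e = e * poly f 1"
proof (induction f)
  case (pCons a f)
  have "e * poly (pCons a f) e = e * a + e * (e * poly f e)" by (simp add: algebra_simps)
  also have "e * (e * poly f e) = e * poly f 1" using pCons assms by (metis mult.assoc)
  finally show ?case by (simp add: algebra_simps)
qed simp

lemma corner_Units_iff:
  fixes e :: "'a::comm_ring_1"
  assumes e: "e * e = e"
  shows "x \<in> Units (corner_ring e) \<longleftrightarrow> e * x = x \<and> (\<exists>w. w * x = e)"
proof -
  have ops: "a \<otimes>\<^bsub>corner_ring e\<^esub> b = a * b" "\<one>\<^bsub>corner_ring e\<^esub> = e" for a b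
    by (simp_all add: corner_ring_def)
  have "\<exists>y. e * y = y \<and> y * x = e" if "w * x = e" for w
    using that e by (intro exI[of _ "e * w"]) (simp add: mult.assoc[symmetric], simp add: mult.assoc)
  moreover have "x \<in> Units (corner_ring e) \<longleftrightarrow> e * x = x \<and> (\<exists>y. e * y = y \<and> y * x = e)"
    unfolding Units_def ops Bex_def corner_ring_carrier_iff[OF e] mem_Collect_eq
    by (metis mult.commute)
  ultimately show ?thesis by blast
qed

text \<open>
  The leading coefficient \<open>e\<close> of \<open>f\<^sub>1\<close> acts as the identity on that of \<open>f\<^sub>0\<close>, so the leading terms
  cannot cancel and the product has the leading coefficient of \<open>f\<^sub>0\<close>.
\<close>
lemma corner_monic_cofactor:
  fixes f\<^sub>0 f\<^sub>1 :: "'a::comm_ring_1 poly"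
  assumes e: "e * e = e" and f: "corner_monic e (f\<^sub>0 * f\<^sub>1)" "corner_monic e f\<^sub>1"
    and f0: "Polynomial.smult e f\<^sub>0 = f\<^sub>0"
  shows "corner_monic e f\<^sub>0"
proof -
  have "lead_coeff f\<^sub>0 = e"
  proof (cases "f\<^sub>0 = 0")
    case True
    then show ?thesis using f(1) by (simp add: corner_monic_def)
  next
    case False
    have "lead_coeff f\<^sub>0 * lead_coeff f\<^sub>1 = coeff (Polynomial.smult e f\<^sub>0) (degree f\<^sub>0)"
      using f(2) by (simp add: corner_monic_def mult.commute)
    then have "lead_coeff f\<^sub>0 * lead_coeff f\<^sub>1 = lead_coeff f\<^sub>0" unfolding f0 .
    then have lc: "coeff (f\<^sub>0 * f\<^sub>1) (degree f\<^sub>0 + degree f\<^sub>1) = lead_coeff f\<^sub>0"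
      by (simp add: coeff_mult_degree_sum)
    then have "degree (f\<^sub>0 * f\<^sub>1) = degree f\<^sub>0 + degree f\<^sub>1"
      using False degree_mult_le[of f\<^sub>0 f\<^sub>1] le_degree[of "f\<^sub>0 * f\<^sub>1"] by (metis le_antisym leading_coeff_0_iff)
    then show ?thesis using lc f(1) by (simp add: corner_monic_def)
  qed
  then show ?thesis using f0 by (simp add: corner_monic_def corner_poly_ring_carrier_iff[OF e])
qed

lemma corner_monic_smult:
  assumes "e * e = e" "\<And>b. b > d \<Longrightarrow> e * coeff g b = 0" "e * coeff g d = e"
  shows "corner_monic e (Polynomial.smult e g)"
proof -
  \<comment> \<open>in the zero corner the zero polynomial is monic, whatever \<open>d\<close> is\<close>
  have "lead_coeff (Polynomial.smult e g) = e"
  proof (cases "e = 0")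
    case False
    have "degree (Polynomial.smult e g) \<le> d" using assms(2) by (intro degree_le) simp
    moreover have "d \<le> degree (Polynomial.smult e g)" using False assms(3) by (intro le_degree) simp
    ultimately have "degree (Polynomial.smult e g) = d" by simp
    then show ?thesis using assms(3) by simp
  qed simp
  then show ?thesis using assms(1) by (simp add: corner_monic_def corner_poly_ring_carrier_iff)
qed

section \<open>Strongly clean matrices from gSRC-factorizations\<close>

lemma strongly_clean_mat_iff:
  "strongly_clean_mat n A \<longleftrightarrow> (\<exists>E U V. E \<in> carrier_mat n n \<and> U \<in> carrier_mat n n \<and> V \<in> carrier_mat n n \<and>
     E * E = E \<and> A = E + U \<and> E * U = U * E \<and> U * V = 1\<^sub>m n \<and> V * U = 1\<^sub>m n)"
  unfolding strongly_clean_def Units_def ring_mat_simps by blast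

text \<open>
  The hypotheses say that \<open>t = P + (t - P)\<close> is a strongly clean decomposition in \<open>R[t]/(\<chi>(A))\<close>. By
  Cayley-Hamilton, evaluation at \<open>A\<close> maps this ring to the matrix ring and \<open>t\<close> to \<open>A\<close>.
\<close>
lemma strongly_clean_mat_of_polys:
  fixes A :: "'a::comm_ring_1 mat"
  assumes A: "A \<in> carrier_mat n n"
    and P: "char_poly A dvd P * P - P" and V: "char_poly A dvd ([:0, 1:] - P) * V - 1"
  shows "strongly_clean_mat n A"
proof -
  let ?f = "mat_poly A"
  note c = mat_poly_closed[OF A]
  have eq: "?f p = ?f q" if "char_poly A dvd p - q" for p q
  proof -
    have "p = (p - q) + q" by simp
    then have "?f p = ?f (p - q) + ?f q" using mat_poly_add[OF A] by metis
    then show ?thesis using mat_poly_char_poly_dvd[OF A that] c[of q] by simp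
  qed
  have comm: "?f p * ?f q = ?f q * ?f p" for p q
    by (simp add: mult.commute flip: mat_poly_mult[OF A])
  show ?thesis
    unfolding strongly_clean_mat_iff
  proof (intro exI conjI)
    show "?f P * ?f P = ?f P" using eq[OF P] by (simp add: mat_poly_mult[OF A])
    show "A = ?f P + ?f ([:0, 1:] - P)"
      by (simp add: mat_poly_X[OF A] flip: mat_poly_add[OF A])
    show "?f ([:0, 1:] - P) * ?f V = 1\<^sub>m n"
      using eq[OF V] by (simp add: mat_poly_mult[OF A] mat_poly_one[OF A])
    then show "?f V * ?f ([:0, 1:] - P) = 1\<^sub>m n" by (simp add: comm)
  qed (rule c comm)+
qed

text \<open>
  By the Chinese remainder theorem \<open>R[t]/(h)\<close> splits, over the corner \<open>e\<close>, into the factors modulo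
  \<open>f\<^sub>0\<close> and modulo \<open>f\<^sub>1\<close>. Modulo \<open>f\<^sub>0\<close> the element \<open>t\<close> is a unit since \<open>f\<^sub>0(0)\<close> is one, and modulo \<open>f\<^sub>1\<close>
  the element \<open>t - 1\<close> is a unit since \<open>f\<^sub>1(1)\<close> is one. Hence \<open>t - P\<close> is a unit for the idempotent
  \<open>P = f\<^sub>0 u\<close>, which is 0 modulo \<open>f\<^sub>0\<close> and 1 modulo \<open>f\<^sub>1\<close>.
\<close>
lemma SRC_factorization_imp_polys:
  fixes h :: "'a::comm_ring_1 poly"
  assumes e: "e * e = e" and SRC: "SRC_factorization e (Polynomial.smult e h) f\<^sub>0 f\<^sub>1"
  shows "\<exists>P V. h dvd Polynomial.smult e (P * P - P)
    \<and> h dvd Polynomial.smult e (([:0, 1:] - P) * V - 1)"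
proof -
  have fac: "Polynomial.smult e h = f\<^sub>0 * f\<^sub>1" and f: "Polynomial.smult e f\<^sub>0 = f\<^sub>0" "Polynomial.smult e f\<^sub>1 = f\<^sub>1"
    using SRC by (auto simp: SRC_factorization_def SR_factorization_def corner_monic_def corner_poly_ring_carrier_iff[OF e])
  obtain u v where uv: "f\<^sub>0 * u + f\<^sub>1 * v = [:e:]"
    using SRC corner_comaximal_iff[OF e f] by (auto simp: SRC_factorization_def)
  obtain w\<^sub>0 w\<^sub>1 where w: "w\<^sub>0 * poly f\<^sub>0 0 = e" "w\<^sub>1 * poly f\<^sub>1 e = e"
    using SRC by (auto simp: SRC_factorization_def SR_factorization_def corner_Units_iff[OF e])
  have w1: "w\<^sub>1 * poly f\<^sub>1 1 * e = e"
    using w(2) corner_poly_eval[OF e, of f\<^sub>1] e by (metis mult.assoc mult.commute)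
  define x :: "'a poly" where "x = [:0, 1:]"
  define l where "l = synthetic_div f\<^sub>0 0"
  define k where "k = synthetic_div f\<^sub>1 1"
  have f0: "f\<^sub>0 = x * l + [:poly f\<^sub>0 0:]"
    using synthetic_div_correct'[of 0 f\<^sub>0] by (simp add: x_def l_def)
  have f1: "f\<^sub>1 = (x - 1) * k + [:poly f\<^sub>1 1:]"
  proof -
    have "x - 1 = [:- 1, 1:]" by (simp add: x_def one_pCons)
    then show ?thesis using synthetic_div_correct'[of 1 f\<^sub>1] by (simp add: k_def)
  qed
  define P where "P = f\<^sub>0 * u"
  define J where "J = f\<^sub>1 * v"
  define W\<^sub>0 W\<^sub>1 where "W\<^sub>0 = [:w\<^sub>0:]" and "W\<^sub>1 = [:w\<^sub>1:]"
  \<comment> \<open>the inverse of \<open>t - P\<close>: the two summands invert \<open>t - 1\<close> modulo \<open>f\<^sub>1\<close> and \<open>t\<close> modulo \<open>f\<^sub>0\<close>\<close>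
  define V where "V = - (W\<^sub>1 * k * P + W\<^sub>0 * l * J)"
  have smult: "Polynomial.smult e P = P" "Polynomial.smult e J = J"
    using f by (metis P_def mult_smult_left, metis J_def mult_smult_left)
  have PJ: "P + J = [:e:]" using uv by (simp add: P_def J_def)
  have N: "P * J = f\<^sub>0 * f\<^sub>1 * (u * v)" by (simp add: P_def J_def mult_ac)
  have "P * (P + J) = P" unfolding PJ using smult by simp
  then have PP: "P * P = P - P * J" by (simp add: distrib_left eq_diff_eq)
  have dvd1: "f\<^sub>0 * f\<^sub>1 dvd P * P - P"
    unfolding PP N by simp
  have k: "W\<^sub>1 * ((x - 1) * k) * P = W\<^sub>1 * (f\<^sub>0 * f\<^sub>1 * u) - P"
  proof -
    have "W\<^sub>1 * ((x - 1) * k) * P = W\<^sub>1 * (f\<^sub>1 - [:poly f\<^sub>1 1:]) * P"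
      using f1 by (metis add_diff_cancel_right')
    also have "\<dots> = W\<^sub>1 * f\<^sub>1 * P - [:w\<^sub>1 * poly f\<^sub>1 1:] * P"
      by (simp add: W\<^sub>0_def W\<^sub>1_def right_diff_distrib left_diff_distrib mult.commute)
    also have "[:w\<^sub>1 * poly f\<^sub>1 1:] * P = [:w\<^sub>1 * poly f\<^sub>1 1:] * Polynomial.smult e P"
      unfolding smult ..
    also have "\<dots> = Polynomial.smult (w\<^sub>1 * poly f\<^sub>1 1 * e) P" by (simp add: mult_ac)
    also have "\<dots> = P" unfolding w1 by (rule smult(1))
    also have "W\<^sub>1 * f\<^sub>1 * P = W\<^sub>1 * (f\<^sub>0 * f\<^sub>1 * u)" by (simp only: P_def mult_ac)
    finally show ?thesis .
  qed
  have l: "W\<^sub>0 * (x * l) * J = W\<^sub>0 * (f\<^sub>0 * f\<^sub>1 * v) - J"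
  proof -
    have "W\<^sub>0 * (x * l) * J = W\<^sub>0 * (f\<^sub>0 - [:poly f\<^sub>0 0:]) * J"
      using f0 by (metis add_diff_cancel_right')
    also have "\<dots> = W\<^sub>0 * f\<^sub>0 * J - [:w\<^sub>0 * poly f\<^sub>0 0:] * J"
      by (simp add: W\<^sub>0_def W\<^sub>1_def right_diff_distrib left_diff_distrib mult.commute)
    also have "[:w\<^sub>0 * poly f\<^sub>0 0:] * J = J" unfolding w using smult(2) by simp
    also have "W\<^sub>0 * f\<^sub>0 * J = W\<^sub>0 * (f\<^sub>0 * f\<^sub>1 * v)" by (simp only: J_def mult_ac)
    finally show ?thesis .
  qed
  have "(x - P) * V = - (W\<^sub>1 * k * (x * P - P * P)) - W\<^sub>0 * l * (x * J - P * J)"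
    by (simp only: V_def) (simp add: algebra_simps)
  also have "\<dots> = - (W\<^sub>1 * ((x - 1) * k) * P) - W\<^sub>1 * k * (P * J)
      - W\<^sub>0 * (x * l) * J + W\<^sub>0 * l * (P * J)"
    unfolding PP by (simp add: algebra_simps)
  also have "\<dots> = f\<^sub>0 * f\<^sub>1 * (- (W\<^sub>1 * u) - W\<^sub>1 * k * (u * v) - W\<^sub>0 * v + W\<^sub>0 * l * (u * v)) + (P + J)"
    unfolding k l N by (simp add: algebra_simps)
  finally have dvd2: "f\<^sub>0 * f\<^sub>1 dvd (x - P) * V - [:e:]"
    unfolding PJ by simp
  have h: "h dvd Polynomial.smult e p" if "f\<^sub>0 * f\<^sub>1 dvd Polynomial.smult e p" for p
    using that unfolding fac[symmetric] by (metis dvd_trans dvd_smult dvd_refl)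
  have "Polynomial.smult e (P * P - P) = P * P - P"
    using smult(1) by (metis mult_smult_left smult_diff_right)
  then have 1: "h dvd Polynomial.smult e (P * P - P)" using h dvd1 by metis
  have "Polynomial.smult e V = V"
  proof -
    have "Polynomial.smult e (q * P) = q * P" "Polynomial.smult e (q * J) = q * J" for q
      using smult by (metis mult_smult_right)+
    then show ?thesis by (simp add: V_def smult_add_right smult_diff_right smult_minus_right)
  qed
  then have "Polynomial.smult e ((x - P) * V - 1) = (x - P) * V - [:e:]"
    by (metis mult_smult_right smult_diff_right smult_one)
  then have "h dvd Polynomial.smult e ((x - P) * V - 1)" using h dvd2 by metis
  with 1 show ?thesis unfolding x_def by blast
qed

lemma gSRC_factorization_imp_polys:
  fixes h :: "'a::comm_ring_1 poly"
  assumes "has_gSRC_factorization h"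
  obtains P V where "h dvd P * P - P" "h dvd ([:0, 1:] - P) * V - 1"
proof -
  obtain S where S: "complete_orthogonal_idempotents S"
    "\<forall>e\<in>S. \<exists>f\<^sub>0 f\<^sub>1. SRC_factorization e (Polynomial.smult e h) f\<^sub>0 f\<^sub>1"
    using assms unfolding has_gSRC_factorization_def by blast
  have idem: "e * e = e" if "e \<in> S" for e
    using S(1) that by (auto simp: complete_orthogonal_idempotents_def)
  have "\<forall>e\<in>S. \<exists>PV. h dvd Polynomial.smult e (fst PV * fst PV - fst PV)
      \<and> h dvd Polynomial.smult e (([:0, 1:] - fst PV) * snd PV - 1)"
    using S(2) SRC_factorization_imp_polys[OF idem, of _ h] by (metis fst_conv snd_conv)
  then obtain PV where PV: "\<forall>e\<in>S. h dvd Polynomial.smult e (fst (PV e) * fst (PV e) - fst (PV e))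
      \<and> h dvd Polynomial.smult e (([:0, 1:] - fst (PV e)) * snd (PV e) - 1)"
    by metis
  \<comment> \<open>local solutions are glued along the decomposition of \<open>R\<close> into the corners\<close>
  define glue :: "('a \<Rightarrow> 'a poly) \<Rightarrow> 'a poly" where "glue p = (\<Sum>e\<in>S. Polynomial.smult e (p e))" for p
  have glue: "Polynomial.smult e (glue p) = Polynomial.smult e (p e)" if e: "e \<in> S" for e p
  proof -
    have "Polynomial.smult e (glue p) = (\<Sum>e'\<in>S. Polynomial.smult (e * e') (p e'))"
      by (simp add: glue_def smult_sum2)
    also have "\<dots> = (\<Sum>e'\<in>S. if e' = e then Polynomial.smult e (p e) else 0)"
      using S(1) e by (intro sum.cong refl) (auto simp: complete_orthogonal_idempotents_def)
    finally show ?thesis using S(1) e by (simp add: complete_orthogonal_idempotents_def)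
  qed
  have local: "h dvd q" if "\<And>e. e \<in> S \<Longrightarrow> h dvd Polynomial.smult e q" for q
  proof -
    have "q = Polynomial.smult (\<Sum>S) q" using S(1) by (simp add: complete_orthogonal_idempotents_def)
    also have "\<dots> = (\<Sum>e\<in>S. Polynomial.smult e q)" by (simp add: smult_sum)
    finally show ?thesis using that by (metis dvd_sum)
  qed
  define P V where "P = glue (\<lambda>e. fst (PV e))" and "V = glue (\<lambda>e. snd (PV e))"
  have mult: "Polynomial.smult e (p * q) = Polynomial.smult e p * Polynomial.smult e q"
    if "e \<in> S" for e p q using idem[OF that] by simp
  have "h dvd Polynomial.smult e (P * P - P)" if e: "e \<in> S" for e
  proof -
    have "Polynomial.smult e (P * P - P) = Polynomial.smult e (fst (PV e) * fst (PV e) - fst (PV e))"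
      by (simp only: smult_diff_right mult[OF e] P_def glue[OF e])
    with PV e show ?thesis by simp
  qed
  moreover have "h dvd Polynomial.smult e (([:0, 1:] - P) * V - 1)" if e: "e \<in> S" for e
  proof -
    have "Polynomial.smult e (([:0, 1:] - P) * V - 1)
        = Polynomial.smult e (([:0, 1:] - fst (PV e)) * snd (PV e) - 1)"
      by (simp only: smult_diff_right mult[OF e] P_def V_def glue[OF e])
    with PV e show ?thesis by simp
  qed
  ultimately show thesis using that local by blast
qed

section \<open>gSRC-factorizations from strongly clean companion matrices\<close>

text \<open>
  On \<open>im E\<close> the matrix \<open>1 - (E + U)\<close> acts as \<open>- U\<close>, and on \<open>im (1 - E)\<close> so does \<open>0 - (E + U)\<close>. By
  multiplicativity, \<open>- V\<close> supplies the inverses of both determinants.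
\<close>
lemma strongly_clean_imp_unit_values:
  fixes E U V :: "'a::comm_ring_1 mat"
  assumes E: "E \<in> carrier_mat n n" "E * E = E" and U: "U \<in> carrier_mat n n" and V: "V \<in> carrier_mat n n"
    and EU: "E * U = U * E" and UV: "U * V = 1\<^sub>m n"
  shows "\<exists>w. w * poly (char_poly_on_image E (E + U)) 1 = 1"
    and "\<exists>w. w * poly (char_poly_on_image (1\<^sub>m n - E) (E + U)) 0 = 1"
proof -
  let ?F = "1\<^sub>m n - E"
  have unit: "\<exists>w. w * det_on_image G (- U) = 1"
    if G: "G \<in> carrier_mat n n" "G * G = G" and GU: "G * U = U * G" for G
  proof -
    have "G * (- U) = (- U) * G" using G U GU by simp
    then have "det_on_image G (- U) * det_on_image G (- V) = det_on_image G ((- U) * (- V))"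
      using G U V by (subst det_on_image_mult[of _ n]) auto
    also have "(- U) * (- V) = 1\<^sub>m n" using U V UV by simp
    finally show ?thesis using det_on_image_one[OF G] by (metis mult.commute)
  qed
  have C: "E + U \<in> carrier_mat n n" using E U by simp
  have "E * (1 \<cdot>\<^sub>m 1\<^sub>m n - (E + U)) = E * (- U)"
  proof -
    have "1 \<cdot>\<^sub>m 1\<^sub>m n - (E + U) = (1\<^sub>m n - E) + (- U)" using E U by (auto intro!: eq_matI)
    also have "E * \<dots> = E * ?F + E * (- U)" using E U by (intro mult_add_distrib_mat) auto
    finally show ?thesis using E U idempotent_complement(1)[OF E] by simp
  qed
  then show "\<exists>w. w * poly (char_poly_on_image E (E + U)) 1 = 1"
    unfolding poly_char_poly_on_image[OF E(1) C] using unit[OF E EU] det_on_image_cong by metis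
  have "?F * (0 \<cdot>\<^sub>m 1\<^sub>m n - (E + U)) = ?F * (- U)"
  proof -
    have "0 \<cdot>\<^sub>m 1\<^sub>m n - (E + U) = - E + (- U)" using E U by (auto intro!: eq_matI)
    also have "?F * \<dots> = ?F * (- E) + ?F * (- U)" using E U by (intro mult_add_distrib_mat) auto
    also have "?F * (- E) = 0\<^sub>m n n"
      using E idempotent_complement(2)[OF E] by (auto intro!: eq_matI)
    also have "0\<^sub>m n n + ?F * (- U) = ?F * (- U)"
      using mult_carrier_mat[OF complement_closed[OF E(1)], of "- U" n] U by (intro left_add_zero_mat) simp
    finally show ?thesis .
  qed
  then show "\<exists>w. w * poly (char_poly_on_image ?F (E + U)) 0 = 1"
    unfolding poly_char_poly_on_image[OF complement_closed[OF E(1)] C]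
    using unit[OF complement_closed[OF E(1)] idempotent_complement(3)[OF E] complement_commute[OF E(1) U EU]]
      det_on_image_cong by metis
qed

text \<open>
  The lower left entry of the matrix \<open>M\<close> from \<open>adjugate_comaximal\<close> is 1 for \<open>Y = t - C\<^sub>h\<close>. This is where
  the companion matrix is special: over any residue field its eigenspaces are one-dimensional, so that
  no eigenvalue can occur both on \<open>im E\<close> and on its complement.
\<close>
lemma companion_char_polys_comaximal:
  fixes h :: "'a::comm_ring_1 poly"
  defines "C \<equiv> companion_matrix h" and "n \<equiv> degree h"
  assumes h: "monic h" "n > 0" and E: "E \<in> carrier_mat n n" "E * E = E" and EC: "E * C = C * E"
  obtains a b where "char_poly_on_image (1\<^sub>m n - E) C * a + char_poly_on_image E C * b = 1"
proof -
  have C: "C \<in> carrier_mat n n" by (simp add: C_def n_def)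
  let ?E = "map_mat (\<lambda>a. [:a:]) E"
  have E': "?E \<in> carrier_mat n n" using E by simp
  note split = char_poly_on_image_split[OF E C EC]
  obtain M A B where M: "M \<in> carrier_mat n n" and AB: "A \<in> carrier_mat n n" "B \<in> carrier_mat n n"
    and LM: "char_poly_matrix C * M = det (char_poly_matrix C) \<cdot>\<^sub>m 1\<^sub>m n"
    and M_eq: "M = char_poly_on_image E C \<cdot>\<^sub>m A + char_poly_on_image (1\<^sub>m n - E) C \<cdot>\<^sub>m B"
    using adjugate_comaximal[OF E' map_const_idempotent[OF E] char_poly_matrix_closed[OF C] split(1)]
    unfolding split(2)[symmetric] char_poly_on_image_def[symmetric] by blast
  have det: "det (char_poly_matrix C) = h"
    using char_poly_companion[OF h(1)] h(2) by (simp add: C_def n_def char_poly_def)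
  have "h * 1 = h * M $$ (n - 1, 0)"
    using companion_adjugate_last_row[OF h(1) M[unfolded n_def] LM[unfolded C_def n_def] h(2)[unfolded n_def]]
    using det by (simp add: C_def n_def)
  then have "M $$ (n - 1, 0) = 1" using monic_mult_cancel[OF h(1)] by metis
  moreover have "M $$ (n - 1, 0) = char_poly_on_image E C * A $$ (n - 1, 0)
      + char_poly_on_image (1\<^sub>m n - E) C * B $$ (n - 1, 0)"
    unfolding M_eq using AB h(2) by simp
  ultimately show thesis using that by (metis add.commute)
qed

lemma strongly_clean_companion_imp_gSRC:
  fixes h :: "'a::comm_ring_1 poly"
  assumes h: "monic h" "degree h > 0"
    and clean: "strongly_clean_mat (degree h) (companion_matrix h)"
  shows "has_gSRC_factorization h"
proof -
  let ?n = "degree h" and ?C = "companion_matrix h"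
  obtain E U V where E: "E \<in> carrier_mat ?n ?n" "E * E = E"
    and U: "U \<in> carrier_mat ?n ?n" and V: "V \<in> carrier_mat ?n ?n"
    and C: "?C = E + U" and EU: "E * U = U * E" and UV: "U * V = 1\<^sub>m ?n"
    using clean unfolding strongly_clean_mat_iff by blast
  have EC: "E * ?C = ?C * E"
    unfolding C using E U EU by (simp add: mult_add_distrib_mat[of _ ?n ?n _ ?n] add_mult_distrib_mat[of _ ?n ?n _ _ ?n])
  define g\<^sub>1 where "g\<^sub>1 = char_poly_on_image E ?C"
  define g\<^sub>0 where "g\<^sub>0 = char_poly_on_image (1\<^sub>m ?n - E) ?C"
  define r where "r = char_poly_on_image E (0\<^sub>m ?n ?n)"
  have fac: "h = g\<^sub>0 * g\<^sub>1"
    using char_poly_on_image_split(3)[OF E companion_matrix_closed EC] char_poly_companion[OF h]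
    by (simp add: g\<^sub>0_def g\<^sub>1_def mult.commute)
  obtain w\<^sub>0 w\<^sub>1 where w: "w\<^sub>0 * poly g\<^sub>0 0 = 1" "w\<^sub>1 * poly g\<^sub>1 1 = 1"
    using strongly_clean_imp_unit_values[OF E U V EU UV] unfolding g\<^sub>0_def g\<^sub>1_def C by blast
  obtain a b where ab: "g\<^sub>0 * a + g\<^sub>1 * b = 1"
    unfolding g\<^sub>0_def g\<^sub>1_def by (rule companion_char_polys_comaximal[OF h E EC])
  have SRC: "SRC_factorization e (Polynomial.smult e h) (Polynomial.smult e g\<^sub>0) (Polynomial.smult e g\<^sub>1)"
    if ed: "e = coeff r d" for e d
  proof -
    let ?s = "Polynomial.smult e"
    have e: "e * e = e" unfolding ed r_def by (rule rank_idempotents(1)[OF E])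
    have fac': "?s h = ?s g\<^sub>0 * ?s g\<^sub>1" by (simp add: fac e)
    have m: "corner_monic e (?s h)"
      using h by (intro corner_monic_smult[OF e, of "degree h"]) (auto simp: coeff_eq_0)
    have m1: "corner_monic e (?s g\<^sub>1)"
      using char_poly_on_image_coeff[OF E companion_matrix_closed]
      by (intro corner_monic_smult[OF e, of d]) (auto simp: ed r_def g\<^sub>1_def)
    have m0: "corner_monic e (?s g\<^sub>0)"
      using m m1 unfolding fac' by (rule corner_monic_cofactor[OF e]) (simp add: e)
    have "w\<^sub>0 * poly (?s g\<^sub>0) 0 = e"
      using w(1) by (simp add: mult.left_commute)
    then have u0: "poly (?s g\<^sub>0) 0 \<in> Units (corner_ring e)"
      unfolding corner_Units_iff[OF e] using e by (auto simp: mult.assoc[symmetric])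
    have "poly (?s g\<^sub>1) e = e * poly g\<^sub>1 1" using corner_poly_eval[OF e] by simp
    then have "w\<^sub>1 * poly (?s g\<^sub>1) e = e"
      using w(2) by (simp add: mult.left_commute)
    then have u1: "poly (?s g\<^sub>1) e \<in> Units (corner_ring e)"
      unfolding corner_Units_iff[OF e] using e by (auto simp: mult.assoc[symmetric])
    have "?s g\<^sub>0 * a + ?s g\<^sub>1 * b = ?s (g\<^sub>0 * a + g\<^sub>1 * b)" by (simp add: smult_add_right)
    also have "\<dots> = [:e:]" by (simp add: ab)
    finally have "Idl\<^bsub>corner_poly_ring e\<^esub> {?s g\<^sub>0, ?s g\<^sub>1} = carrier (corner_poly_ring e)"
      by (subst corner_comaximal_iff[OF e]) (auto simp: e)
    then show ?thesis
      unfolding SRC_factorization_def SR_factorization_def using m m0 m1 fac' u0 u1 by blast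
  qed
  have "complete_orthogonal_idempotents (coeff r ` {..degree r})"
    unfolding r_def by (rule rank_idempotents(2)[OF E])
  then show ?thesis unfolding has_gSRC_factorization_def using SRC by blast
qed

theorem corollary10:
  fixes h :: "'a::comm_ring_1 poly" and n :: nat
  assumes "\<And>x :: 'a set. x \<in> boolean_spectrum \<Longrightarrow> projective_free (pierce_stalk x)"
    and "n \<ge> 2"
    and "monic h" and "degree h = n"
  shows "((\<forall>A \<in> carrier_mat n n. char_poly A = h \<longrightarrow> strongly_clean_mat n A)
            \<longleftrightarrow> strongly_clean_mat n (companion_matrix h))
       \<and> (strongly_clean_mat n (companion_matrix h) \<longleftrightarrow> has_gSRC_factorization h)"
proof -
  have h: "monic h" "degree h > 0" using assms by auto
  have "strongly_clean_mat n (companion_matrix h)"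
    if "\<forall>A \<in> carrier_mat n n. char_poly A = h \<longrightarrow> strongly_clean_mat n A"
    using that companion_matrix_closed[of h] char_poly_companion[OF h] assms(4) by auto
  moreover have "has_gSRC_factorization h" if "strongly_clean_mat n (companion_matrix h)"
    using strongly_clean_companion_imp_gSRC[OF h] that assms(4) by simp
  moreover have "\<forall>A \<in> carrier_mat n n. char_poly A = h \<longrightarrow> strongly_clean_mat n A"
    if gSRC: "has_gSRC_factorization h"
  proof -
    obtain P V where "h dvd P * P - P" "h dvd ([:0, 1:] - P) * V - 1"
      using gSRC by (rule gSRC_factorization_imp_polys)
    then show ?thesis using strongly_clean_mat_of_polys by blast
  qed
  ultimately show ?thesis by blast
qed

end
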